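(* Let $\mathbf{K}$ be a field of characteristic $p>3$, let $G$ be an abelian group with bicharacter $\varepsilon$, and let $L=\bigoplus_{\gamma\in G}L_\gamma$ be a Lie color algebra over $\mathbf{K}$. Assume that for every $\gamma\in G_+$ there exist a basis $(e_{j,\gamma})_{j\in J_\gamma}$ of $L_\gamma$ and elements $y_{j,\gamma}\in L_{p\gamma}$ ($j\in J_\gamma$) such that $(\operatorname{ad}_{e_{j,\gamma}})^p=\operatorname{ad}_{y_{j,\gamma}}$ on $L$ for all $j\in J_\gamma$. Then there exists exactly one $p$-map structure $(\cdot)^{[p]}:L_\gamma\to L_{p\gamma}$ ($\gamma\in G_+$) making $L$ a restricted Lie color algebra such that $e_{j,\gamma}^{[p]}=y_{j,\gamma}$ for all $\gamma\in G_+$ and all $j\in J_\gamma$.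
   Context: A (symmetric) bicharacter on an abelian group $(G,+)$ is a map $\varepsilon:G\times G\to\mathbf{K}^*$ with $\varepsilon(\alpha+\beta,\gamma)=\varepsilon(\alpha,\gamma)\varepsilon(\beta,\gamma)$, $\varepsilon(\alpha,\beta+\gamma)=\varepsilon(\alpha,\beta)\varepsilon(\alpha,\gamma)$, $\varepsilon(\alpha,\beta)\varepsilon(\beta,\alpha)=1$. Put $G_+=\{\gamma\in G:\varepsilon(\gamma,\gamma)=1\}$. For a homogeneous element $x$ of a $G$-graded space, $\bar x\in G$ is its degree. A Lie color algebra is a $G$-graded vector space $L=\bigoplus_{\gamma\in G}L_\gamma$ with a bilinear bracket such that $[L_i,L_j]\subset L_{i+j}$ and, for homogeneous $x,y,z$: $[x,y]=-\varepsilon(\bar x,\bar y)[y,x]$ and $\varepsilon(\bar z,\bar x)[x,[y,z]]+\varepsilon(\bar x,\bar y)[y,[z,x]]+\varepsilon(\bar y,\bar z)[z,[x,y]]=0$. Write $\operatorname{ad}_x(y)=[x,y]$. A restricted Lie color algebra (characteristic $p>3$) is a Lie color algebra $L$ with maps $(\cdot)^{[p]}:L_\gamma\to L_{p\gamma}$ for each $\gamma\in G_+$ (together called a $p$-map) such that for all $\gamma\in G_+$: (1) $(\alpha x)^{[p]}=\alpha^p x^{[p]}$ for $\alpha\in\mathbf{K}$, $x\in L_\gamma$; (2) $[x^{[p]},y]=(\operatorname{ad}_x)^p(y)$ for $x\in L_\gamma$, $y\in L$; (3) $(x+y)^{[p]}=x^{[p]}+y^{[p]}+\sum_{i=1}^{p-1}s_i(x,y)$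 for $x,y\in L_\gamma$, where $i\,s_i(x,y)$ is the coefficient of $\lambda^{i-1}$ in $(\operatorname{ad}_{\lambda x+y})^{p-1}(x)$. *)

theory Defs
  imports "HOL-Computational_Algebra.Computational_Algebra" "HOL-Library.FuncSet"
begin

definition nat_mult :: "nat \<Rightarrow> 'g::ab_group_add \<Rightarrow> 'g" where
  "nat_mult n \<gamma> = (\<Sum>_\<in>{..<n}. \<gamma>)"

locale bicharacter =
  fixes \<epsilon> :: "'g::ab_group_add \<Rightarrow> 'g \<Rightarrow> 'k::field"
  assumes nonzero: "\<epsilon> \<alpha> \<beta> \<noteq> 0"
    and add_left: "\<epsilon> (\<alpha> + \<beta>) \<gamma> = \<epsilon> \<alpha> \<gamma> * \<epsilon> \<beta> \<gamma>"
    and add_right: "\<epsilon> \<alpha> (\<beta> + \<gamma>) = \<epsilon> \<alpha> \<beta> * \<epsilon> \<alpha> \<gamma>"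
    and symmetric: "\<epsilon> \<alpha> \<beta> * \<epsilon> \<beta> \<alpha> = 1"

definition G_plus :: "('g \<Rightarrow> 'g \<Rightarrow> 'k::one) \<Rightarrow> 'g set" where
  "G_plus \<epsilon> = {\<gamma>. \<epsilon> \<gamma> \<gamma> = 1}"

context vector_space
begin

text \<open>The whole type \<open>'b\<close> is the internal direct sum of the family \<open>L\<close> of subspaces.\<close>

definition grading :: "('g \<Rightarrow> 'b set) \<Rightarrow> bool" where
  "grading L \<longleftrightarrow> (\<forall>\<gamma>. subspace (L \<gamma>)) \<and>
     (\<forall>x. \<exists>!c. (\<forall>\<gamma>. c \<gamma> \<in> L \<gamma>) \<and> finite {\<gamma>. c \<gamma> \<noteq> 0} \<and> x = (\<Sum>\<gamma> | c \<gamma> \<noteq> 0. c \<gamma>))"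

definition indexed_basis :: "'b set \<Rightarrow> 'j set \<Rightarrow> ('j \<Rightarrow> 'b) \<Rightarrow> bool" where
  "indexed_basis V J e \<longleftrightarrow> inj_on e J \<and> independent (e ` J) \<and> span (e ` J) = V"

end

locale lie_color_algebra = vector_space scale + bicharacter \<epsilon>
  for scale :: "'k::field \<Rightarrow> 'l::ab_group_add \<Rightarrow> 'l"
    and \<epsilon> :: "'g::ab_group_add \<Rightarrow> 'g \<Rightarrow> 'k" +
  fixes L :: "'g \<Rightarrow> 'l set"
    and bracket :: "'l \<Rightarrow> 'l \<Rightarrow> 'l"
  assumes graded: "grading L"
    and linear_left: "Vector_Spaces.linear scale scale (\<lambda>x. bracket x y)"
    and linear_right: "Vector_Spaces.linear scale scale (\<lambda>y. bracket x y)"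
    and bracket_degree: "\<lbrakk>x \<in> L \<alpha>; y \<in> L \<beta>\<rbrakk> \<Longrightarrow> bracket x y \<in> L (\<alpha> + \<beta>)"
    and color_antisym:
      "\<lbrakk>x \<in> L \<alpha>; y \<in> L \<beta>\<rbrakk> \<Longrightarrow> bracket x y = - scale (\<epsilon> \<alpha> \<beta>) (bracket y x)"
    and color_jacobi:
      "\<lbrakk>x \<in> L \<alpha>; y \<in> L \<beta>; z \<in> L \<gamma>\<rbrakk> \<Longrightarrow>
         scale (\<epsilon> \<gamma> \<alpha>) (bracket x (bracket y z))
         + scale (\<epsilon> \<alpha> \<beta>) (bracket y (bracket z x))
         + scale (\<epsilon> \<beta> \<gamma>) (bracket z (bracket x y)) = 0"

text \<open>The extension of a bilinear bracket on \<open>L\<close> to \<open>L[\<lambda>] = L \<otimes> K[\<lambda>]\<close>; elements of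
  \<open>L[\<lambda>]\<close> are polynomials in \<open>\<lambda>\<close> with coefficients in \<open>L\<close>.\<close>

definition poly_bracket :: "('l::ab_group_add \<Rightarrow> 'l \<Rightarrow> 'l) \<Rightarrow> 'l poly \<Rightarrow> 'l poly \<Rightarrow> 'l poly" where
  "poly_bracket br P Q =
     (\<Sum>i\<le>degree P. \<Sum>j\<le>degree Q. monom (br (coeff P i) (coeff Q j)) (i + j))"

text \<open>\<open>[:y, x:]\<close> is \<open>\<lambda>x + y\<close>, and \<open>[:x:]\<close> is the constant polynomial \<open>x\<close>. The coefficient
  of \<open>\<lambda>\<^sup>i\<^sup>-\<^sup>1\<close> is \<open>i s\<^sub>i(x,y)\<close>; the factor \<open>i\<close> is invertible in the field for \<open>0 < i < p\<close>
  in characteristic \<open>p\<close>.\<close>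

definition jacobson_s ::
  "('k::field \<Rightarrow> 'l::ab_group_add \<Rightarrow> 'l) \<Rightarrow> ('l \<Rightarrow> 'l \<Rightarrow> 'l) \<Rightarrow> nat \<Rightarrow> nat \<Rightarrow> 'l \<Rightarrow> 'l \<Rightarrow> 'l" where
  "jacobson_s scale br p i x y =
     scale (inverse (of_nat i)) (coeff ((poly_bracket br [:y, x:] ^^ (p - 1)) [:x:]) (i - 1))"

text \<open>A \<open>p\<close>-map is a family of maps \<open>L\<^sub>\<gamma> \<rightarrow> L\<^sub>p\<^sub>\<gamma>\<close> indexed by \<open>\<gamma> \<in> G\<^sub>+\<close>. The extensional function
  space fixes the irrelevant values of the underlying total function (outside \<open>G\<^sub>+\<close>, and outside
  \<open>L\<^sub>\<gamma>\<close> for each \<open>\<gamma>\<close>), so that equality of such functions is equality of families of maps.\<close>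

locale restricted_lie_color_algebra = lie_color_algebra scale \<epsilon> L bracket
  for scale :: "'k::field \<Rightarrow> 'l::ab_group_add \<Rightarrow> 'l"
    and \<epsilon> :: "'g::ab_group_add \<Rightarrow> 'g \<Rightarrow> 'k"
    and L :: "'g \<Rightarrow> 'l set"
    and bracket :: "'l \<Rightarrow> 'l \<Rightarrow> 'l" +
  fixes p :: nat
    and pmap :: "'g \<Rightarrow> 'l \<Rightarrow> 'l"
  assumes characteristic: "CHAR('k) = p" "p > 3"
    and pmap_maps: "pmap \<in> (\<Pi>\<^sub>E \<gamma>\<in>G_plus \<epsilon>. L \<gamma> \<rightarrow>\<^sub>E L (nat_mult p \<gamma>))"
    and pmap_scale:
      "\<lbrakk>\<gamma> \<in> G_plus \<epsilon>; x \<in> L \<gamma>\<rbrakk> \<Longrightarrow> pmap \<gamma> (scale a x) = scale (a ^ p) (pmap \<gamma> x)"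
    and pmap_ad:
      "\<lbrakk>\<gamma> \<in> G_plus \<epsilon>; x \<in> L \<gamma>\<rbrakk> \<Longrightarrow> bracket (pmap \<gamma> x) y = (bracket x ^^ p) y"
    and pmap_add:
      "\<lbrakk>\<gamma> \<in> G_plus \<epsilon>; x \<in> L \<gamma>; y \<in> L \<gamma>\<rbrakk> \<Longrightarrow>
         pmap \<gamma> (x + y) = pmap \<gamma> x + pmap \<gamma> y + (\<Sum>i=1..p-1. jacobson_s scale bracket p i x y)"

end

theory Submission
  imports Defs
begin

text \<open>The elements of degrees \<open>n\<gamma>\<close>, where \<open>\<gamma> \<in> G\<^sub>+\<close>, form an ordinary Lie algebra. Write
  \<open>s(x, y)\<close> for the sum of the \<open>s\<^sub>i(x, y)\<close>. In characteristic \<open>p\<close> the Leibniz rule shows that the one-form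
  \<open>v \<mapsto> (ad a)\<^sup>p\<^sup>-\<^sup>1 v\<close> is closed, because \<open>p\<close> divides the binomial coefficients that occur. Evaluated at \<open>a = \<lambda>x + \<mu>y + z\<close>, this says that the
  polarizations of \<open>a\<^sup>p\<close> do not depend on the order of integration; hence \<open>s\<close> is a symmetric two-cocycle,
  and no embedding into an enveloping algebra is needed. The addition
  \<open>(x, u) + (y, v) = (x + y, u + v + s(x, y))\<close> is therefore associative and commutative, and a \<open>p\<close>-map on
  \<open>L\<^sub>\<gamma>\<close> is a \<open>p\<close>-semilinear section of this extension, which is determined by, and can be prescribed
  on, a basis. The same Leibniz expansion gives \<open>(ad (x + y))\<^sup>p = (ad x)\<^sup>p + (ad y)\<^sup>p + ad s(x, y)\<close>, so the
  compatibility with \<open>ad\<close> propagates from the basis.\<close>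

section \<open>Multiples in abelian groups and biadditive maps\<close>

lemma nat_mult_0 [simp]: "nat_mult 0 x = 0"
  by (simp add: nat_mult_def)

lemma nat_mult_Suc: "nat_mult (Suc n) x = nat_mult n x + x"
  by (simp add: nat_mult_def)

lemma nat_mult_1 [simp]: "nat_mult (Suc 0) x = x"
  by (simp add: nat_mult_Suc)

lemma nat_mult_zero_right [simp]: "nat_mult n 0 = 0"
  by (simp add: nat_mult_def)

lemma nat_mult_add_left: "nat_mult (m + n) x = nat_mult m x + nat_mult n x"
  by (induction m) (simp_all add: nat_mult_Suc algebra_simps)

lemma nat_mult_add_right: "nat_mult n (x + y) = nat_mult n x + nat_mult n y"
  by (simp add: nat_mult_def sum.distrib)

lemma nat_mult_minus: "nat_mult n (- x) = - nat_mult n x"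
  by (simp add: nat_mult_def sum_negf)

lemma nat_mult_mult: "nat_mult (m * n) x = nat_mult n (nat_mult m x)"
  by (induction n) (simp_all add: nat_mult_Suc nat_mult_add_left algebra_simps)

lemma nat_mult_sum: "nat_mult n (sum f A) = (\<Sum>x\<in>A. nat_mult n (f x))"
  unfolding nat_mult_def by (rule sum.swap)

lemma (in additive) nat_mult: "f (nat_mult n x) = nat_mult n (f x)"
  by (simp add: nat_mult_def sum)

lemma nat_mult_dvd_eq_0:
  assumes "nat_mult p x = 0" "p dvd n"
  shows "nat_mult n x = 0"
  using assms by (auto simp: nat_mult_mult)

lemma fps_nth_nat_mult [simp]: "fps_nth (nat_mult n f) i = nat_mult n (fps_nth f i)"
  by (simp add: nat_mult_def fps_sum_nth)

locale biadditive =
  fixes B :: "'a::ab_group_add \<Rightarrow> 'b::ab_group_add \<Rightarrow> 'c::ab_group_add"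
  assumes add_left: "B (x + x') y = B x y + B x' y"
    and add_right: "B x (y + y') = B x y + B x y'"
begin

sublocale left: additive "\<lambda>x. B x y" for y
  by unfold_locales (rule add_left)

sublocale right: additive "B x" for x
  by unfold_locales (rule add_right)

lemmas zero = left.zero right.zero

end

subsection \<open>Extension of scalars to power series\<close>

text \<open>Extension of a biadditive map to series in one variable. Power series avoid degree
  bookkeeping, and applying \<open>conv\<close> twice yields two variables.\<close>

definition conv ::
  "('a::ab_group_add \<Rightarrow> 'b::ab_group_add \<Rightarrow> 'c::ab_group_add) \<Rightarrow> 'a fps \<Rightarrow> 'b fps \<Rightarrow> 'c fps" where
  "conv B f g = Abs_fps (\<lambda>n. \<Sum>i\<le>n. B (fps_nth f i) (fps_nth g (n - i)))"

definition deriv_fps :: "'a::ab_group_add fps \<Rightarrow> 'a fps" where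
  "deriv_fps f = Abs_fps (\<lambda>n. nat_mult (Suc n) (fps_nth f (Suc n)))"

text \<open>On series of series, \<open>map_coeffs deriv_fps\<close> is the partial derivative in
  the inner variable, while \<open>deriv_fps\<close> is the one in the outer variable.\<close>

definition map_coeffs :: "('a \<Rightarrow> 'b) \<Rightarrow> 'a fps \<Rightarrow> 'b fps" where
  "map_coeffs h f = Abs_fps (\<lambda>n. h (fps_nth f n))"

lemma sum_triangle_nested:
  fixes g :: "nat \<Rightarrow> nat \<Rightarrow> 'a::comm_monoid_add"
  shows "(\<Sum>i\<le>n. \<Sum>j\<le>n - i. g i j) = (\<Sum>k\<le>n. \<Sum>i\<le>k. g i (k - i))"
proof -
  have "(\<Sum>i\<le>n. \<Sum>j\<le>n - i. g i j) = (\<Sum>(i, j)\<in>(SIGMA i:{..n}. {..n - i}). g i j)"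
    by (simp add: sum.Sigma)
  also have "(SIGMA i:{..n}. {..n - i}) = {(i, j). i + j \<le> n}"
    by auto
  finally show ?thesis
    by (simp add: sum.triangle_reindex_eq)
qed

lemma biadditive_conv:
  assumes "biadditive B"
  shows "biadditive (conv B)"
proof -
  interpret biadditive B by fact
  show ?thesis
    by unfold_locales (auto intro!: fps_ext simp: conv_def add_left add_right sum.distrib)
qed

lemma conv_leibniz:
  assumes "biadditive act"
    and leibniz: "\<And>a f g. act a (act f g) = act (br a f) g + act f (act a g)"
  shows "conv act a (conv act f g) = conv act (conv br a f) g + conv act f (conv act a g)"
proof (rule fps_ext)
  fix n
  interpret act: biadditive act by fact
  have "fps_nth (conv act a (conv act f g)) n =
     (\<Sum>i\<le>n. \<Sum>j\<le>n - i. act (br (fps_nth a i) (fps_nth f j)) (fps_nth g (n - i - j)))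
     + (\<Sum>i\<le>n. \<Sum>j\<le>n - i. act (fps_nth f j) (act (fps_nth a i) (fps_nth g (n - i - j))))"
    by (simp add: conv_def act.right.sum sum.distrib[symmetric] leibniz[symmetric])
  also have "(\<Sum>i\<le>n. \<Sum>j\<le>n - i. act (br (fps_nth a i) (fps_nth f j)) (fps_nth g (n - i - j)))
      = fps_nth (conv act (conv br a f) g) n"
    by (subst sum_triangle_nested) (simp add: conv_def act.left.sum)
  also have "(\<Sum>i\<le>n. \<Sum>j\<le>n - i. act (fps_nth f j) (act (fps_nth a i) (fps_nth g (n - i - j))))
      = (\<Sum>j\<le>n. \<Sum>i\<le>n - j. act (fps_nth f j) (act (fps_nth a i) (fps_nth g (n - j - i))))"
    unfolding sum.Sigma[OF finite_atMost ballI[OF finite_atMost]]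
    by (rule sum.reindex_bij_witness[of _ "\<lambda>(i, j). (j, i)" "\<lambda>(i, j). (j, i)"])
      (auto simp: add.commute)
  also have "\<dots> = fps_nth (conv act f (conv act a g)) n"
    by (simp add: conv_def act.right.sum)
  finally show "fps_nth (conv act a (conv act f g)) n =
      fps_nth (conv act (conv br a f) g + conv act f (conv act a g)) n"
    by simp
qed

lemma additive_deriv_fps: "additive deriv_fps"
  by unfold_locales (auto intro!: fps_ext simp: deriv_fps_def nat_mult_add_right)

lemma deriv_fps_conv:
  assumes "biadditive B"
  shows "deriv_fps (conv B f g) = conv B (deriv_fps f) g + conv B f (deriv_fps g)"
proof (rule fps_ext)
  fix n
  interpret biadditive B by fact
  let ?t = "\<lambda>i. B (fps_nth f i) (fps_nth g (Suc n - i))"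
  have "fps_nth (deriv_fps (conv B f g)) n = (\<Sum>i\<le>Suc n. nat_mult (Suc n) (?t i))"
    by (simp only: deriv_fps_def conv_def fps_nth_Abs_fps nat_mult_sum)
  \<comment> \<open>The degree \<open>Suc n\<close> splits as \<open>i\<close> plus
    \<open>Suc n - i\<close>, and each part is the factor produced by differentiating one of the two
    series.\<close>
  also have "\<dots> = (\<Sum>i\<le>Suc n. nat_mult i (?t i)) + (\<Sum>i\<le>Suc n. nat_mult (Suc n - i) (?t i))"
    by (simp del: sum.atMost_Suc add: sum.distrib[symmetric] nat_mult_add_left[symmetric])
  also have "(\<Sum>i\<le>Suc n. nat_mult i (?t i)) = fps_nth (conv B (deriv_fps f) g) n"
    by (subst sum.atMost_Suc_shift) (simp add: conv_def deriv_fps_def left.nat_mult)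
  also have "(\<Sum>i\<le>Suc n. nat_mult (Suc n - i) (?t i)) = fps_nth (conv B f (deriv_fps g)) n"
    by (simp add: conv_def deriv_fps_def right.nat_mult Suc_diff_le)
  finally show "fps_nth (deriv_fps (conv B f g)) n =
      fps_nth (conv B (deriv_fps f) g + conv B f (deriv_fps g)) n"
    by simp
qed

lemma map_coeffs_conv:
  assumes "additive h" "\<And>f g. h (B f g) = B (h f) g + B f (h g)"
  shows "map_coeffs h (conv B f g) = conv B (map_coeffs h f) g + conv B f (map_coeffs h g)"
proof -
  interpret additive h by fact
  show ?thesis
    by (auto intro!: fps_ext simp: conv_def map_coeffs_def sum assms(2) sum.distrib)
qed

lemma conv_nth_linear:
  assumes "biadditive B" "\<And>k. fps_nth a (Suc (Suc k)) = 0"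
  shows "fps_nth (conv B a f) n =
    B (fps_nth a 0) (fps_nth f n) + (case n of 0 \<Rightarrow> 0 | Suc m \<Rightarrow> B (fps_nth a (Suc 0)) (fps_nth f m))"
proof -
  interpret biadditive B by fact
  have "(\<Sum>i\<le>m. B (fps_nth a (Suc i)) (fps_nth f (m - i))) = B (fps_nth a (Suc 0)) (fps_nth f m)" for m
    by (cases m) (simp_all only: sum.atMost_Suc_shift, simp_all add: assms(2) zero)
  then show ?thesis
    by (cases n) (simp_all only: conv_def fps_nth_Abs_fps sum.atMost_Suc_shift, simp_all)
qed

subsection \<open>Leibniz expansions in characteristic p\<close>

text \<open>Applying \<delta> replaces one factor \<open>c\<close> by \<open>B w\<close>. Moving the
  remaining factors on its left to the right by the Leibniz rule differentiates \<open>w\<close>,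
  and counting the positions gives the binomial coefficients.\<close>

lemma deriv_power:
  assumes "biadditive B" "additive c"
    and leibniz: "\<And>f g. c (B f g) = B (D f) g + B f (c g)"
    and deriv: "\<And>g. \<delta> (c g) = B w g + c (\<delta> g)"
    and "\<delta> v = 0"
  shows "\<delta> ((c ^^ Suc n) v) =
    (\<Sum>r\<le>n. nat_mult (Suc n choose Suc r) (B ((D ^^ r) w) ((c ^^ (n - r)) v)))"
proof (induction n)
  case 0
  interpret c: additive c by fact
  show ?case
    by (simp add: deriv \<open>\<delta> v = 0\<close> c.zero)
next
  case (Suc n)
  interpret c: additive c by fact
  let ?t = "\<lambda>r. B ((D ^^ r) w) ((c ^^ (Suc n - r)) v)"
  have "\<delta> ((c ^^ Suc (Suc n)) v) = ?t 0 + c (\<delta> ((c ^^ Suc n) v))"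
    by (simp add: deriv)
  also have "c (\<delta> ((c ^^ Suc n) v)) = (\<Sum>r\<le>n. nat_mult (Suc n choose Suc r)
      (?t (Suc r) + ?t r))"
    by (simp only: Suc.IH c.sum c.nat_mult leibniz) (simp add: Suc_diff_le)
  \<comment> \<open>The second sum gains the index \<open>Suc n\<close>, where its binomial
    coefficient vanishes. The term \<open>?t 0\<close> then completes the shifted first sum, and
    Pascal's rule applies termwise.\<close>
  also have "\<dots> = (\<Sum>r\<le>n. nat_mult (Suc n choose Suc r) (?t (Suc r)))
      + (\<Sum>r\<le>Suc n. nat_mult (Suc n choose Suc r) (?t r))"
    by (simp add: nat_mult_add_right sum.distrib binomial_eq_0)
  finally have "\<delta> ((c ^^ Suc (Suc n)) v) =
     (\<Sum>r\<le>Suc n. nat_mult (Suc n choose r) (?t r)) + (\<Sum>r\<le>Suc n. nat_mult (Suc n choose Suc r) (?t r))"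
    by (simp only: sum.atMost_Suc_shift[of "\<lambda>r. nat_mult (Suc n choose r) (?t r)"]) simp
  also have "\<dots> = (\<Sum>r\<le>Suc n. nat_mult (Suc (Suc n) choose Suc r) (?t r))"
    by (simp only: sum.distrib[symmetric] nat_mult_add_left[symmetric] binomial_Suc_Suc)
  finally show ?case .
qed

lemma deriv_power_prime:
  fixes B :: "'a::ab_group_add \<Rightarrow> 'b::ab_group_add \<Rightarrow> 'b"
  assumes "prime p" "\<And>u::'b. nat_mult p u = 0"
    and "biadditive B" "additive c"
    and "\<And>f g. c (B f g) = B (D f) g + B f (c g)"
    and "\<And>g. \<delta> (c g) = B w g + c (\<delta> g)"
    and "\<delta> v = 0"
  shows "\<delta> ((c ^^ p) v) = B ((D ^^ (p - 1)) w) v"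
proof -
  obtain n where n: "p = Suc n"
    using prime_gt_0_nat[OF \<open>prime p\<close>] gr0_conv_Suc by auto
  let ?t = "\<lambda>r. nat_mult (Suc n choose Suc r) (B ((D ^^ r) w) ((c ^^ (n - r)) v))"
  have "?t r = 0" if "r < n" for r
    by (rule nat_mult_dvd_eq_0[OF assms(2)]) (use that n \<open>prime p\<close> in \<open>simp del: binomial_Suc_Suc add: dvd_choose_prime\<close>)
  then have "(\<Sum>r\<le>n. ?t r) = (\<Sum>r\<in>{n}. ?t r)"
    by (intro sum.mono_neutral_right) auto
  then show ?thesis
    using deriv_power[OF assms(3-7), of n] unfolding n by simp
qed

locale lie_ring = biadditive br
  for br :: "'a::ab_group_add \<Rightarrow> 'a \<Rightarrow> 'a" +
  assumes antisym: "br x y = - br y x"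
    and leibniz: "br x (br y z) = br (br x y) z + br y (br x z)"

lemma lie_ring_conv:
  assumes "lie_ring br"
  shows "lie_ring (conv br)"
proof -
  interpret lie_ring br by fact
  interpret conv: biadditive "conv br"
    by (rule biadditive_conv) unfold_locales
  show ?thesis
  proof
    fix f g h :: "'a fps"
    show "conv br f (conv br g h) = conv br (conv br f g) h + conv br g (conv br f h)"
      by (rule conv_leibniz) (unfold_locales, rule leibniz)
    show "conv br f g = - conv br g f"
    proof (rule fps_ext)
      fix n
      have "(\<Sum>i\<le>n. br (fps_nth f i) (fps_nth g (n - i))) = (\<Sum>i\<le>n. br (fps_nth f (n - i)) (fps_nth g i))"
        by (rule sum.reindex_bij_witness[of _ "\<lambda>i. n - i" "\<lambda>i. n - i"]) auto
      also have "\<dots> = (\<Sum>i\<le>n. - br (fps_nth g i) (fps_nth f (n - i)))"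
        by (intro sum.cong refl antisym)
      finally show "fps_nth (conv br f g) n = fps_nth (- conv br g f) n"
        by (simp add: conv_def sum_negf)
    qed
  qed
qed

text \<open>The one-form \<open>v \<mapsto> (ad a)\<^sup>p\<^sup>-\<^sup>1 v\<close>, which is formally the differential of \<open>a \<mapsto> a\<^sup>p\<close>, is closed.\<close>

lemma (in lie_ring) ad_power_closed:
  assumes "prime p" "\<And>u::'a. nat_mult p u = 0"
    and \<delta>\<^sub>1: "\<And>f g. \<delta>\<^sub>1 (br f g) = br (\<delta>\<^sub>1 f) g + br f (\<delta>\<^sub>1 g)" "\<delta>\<^sub>1 a = x" "\<delta>\<^sub>1 y = 0"
    and \<delta>\<^sub>2: "\<And>f g. \<delta>\<^sub>2 (br f g) = br (\<delta>\<^sub>2 f) g + br f (\<delta>\<^sub>2 g)" "\<delta>\<^sub>2 a = y" "\<delta>\<^sub>2 x = 0"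
  shows "\<delta>\<^sub>2 ((br a ^^ (p - 1)) x) = \<delta>\<^sub>1 ((br a ^^ (p - 1)) y)"
proof -
  obtain n where n: "p = Suc (Suc n)"
    using prime_ge_2_nat[OF \<open>prime p\<close>] by (metis One_nat_def Suc_1 Suc_le_D Suc_le_mono)
  let ?t = "\<lambda>k r. nat_mult k (br ((br a ^^ r) y) ((br a ^^ (n - r)) x))"
  have 2: "\<delta>\<^sub>2 ((br a ^^ Suc n) x) = (\<Sum>r\<le>n. ?t (Suc n choose Suc r) r)"
    by (rule deriv_power[of br "br a" "br a" \<delta>\<^sub>2 y x])
      (rule biadditive_axioms | rule right.additive_axioms | rule leibniz | simp add: \<delta>\<^sub>2)+
  have "\<delta>\<^sub>1 ((br a ^^ Suc n) y) =
      (\<Sum>r\<le>n. nat_mult (Suc n choose Suc r) (br ((br a ^^ r) x) ((br a ^^ (n - r)) y)))"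
    by (rule deriv_power[of br "br a" "br a" \<delta>\<^sub>1 x y])
      (rule biadditive_axioms | rule right.additive_axioms | rule leibniz | simp add: \<delta>\<^sub>1)+
  \<comment> \<open>Reversing the order of summation and swapping the arguments by antisymmetry
    gives the brackets that occur in the other expansion.\<close>
  also have "\<dots> = (\<Sum>r\<le>n. nat_mult (Suc n choose Suc (n - r)) (br ((br a ^^ (n - r)) x) ((br a ^^ r) y)))"
    by (rule sum.reindex_bij_witness[of _ "\<lambda>i. n - i" "\<lambda>i. n - i"]) auto
  also have "\<dots> = (\<Sum>r\<le>n. - ?t (Suc n choose r) r)"
  proof (intro sum.cong refl)
    fix r assume "r \<in> {..n}"
    then have "Suc n choose Suc (n - r) = Suc n choose r"
      by (subst binomial_symmetric) (auto simp del: binomial_Suc_Suc simp: Suc_diff_le)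
    then show "nat_mult (Suc n choose Suc (n - r)) (br ((br a ^^ (n - r)) x) ((br a ^^ r) y))
        = - ?t (Suc n choose r) r"
      by (subst antisym) (simp add: nat_mult_minus)
  qed
  \<comment> \<open>Pascal's rule merges the two coefficients into \<open>p choose Suc r\<close>, a
    multiple of \<open>p\<close> for \<open>r \<le> n\<close>.\<close>
  finally have "\<delta>\<^sub>2 ((br a ^^ Suc n) x) - \<delta>\<^sub>1 ((br a ^^ Suc n) y) = (\<Sum>r\<le>n. ?t (p choose Suc r) r)"
    unfolding 2 n binomial_Suc_Suc[of "Suc n"]
    by (simp only: nat_mult_add_left sum.distrib sum_negf diff_minus_eq_add add.commute)
  also have "\<dots> = 0"
  proof (rule sum.neutral, rule ballI)
    fix r assume "r \<in> {..n}"
    then have "p dvd (p choose Suc r)"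
      using \<open>prime p\<close> n by (intro dvd_choose_prime) auto
    then show "?t (p choose Suc r) r = 0"
      by (rule nat_mult_dvd_eq_0[OF assms(2)])
  qed
  finally show ?thesis
    by (simp add: n)
qed

subsection \<open>Coefficients of powers of a linear pencil\<close>

text \<open>\<open>pencil act x y v m i\<close> is the coefficient of \<open>\<lambda>\<^sup>i\<close> in \<open>act (\<lambda>x + y)\<^sup>m v\<close>, and \<open>pencil2 act x y z v m i j\<close>
  is the coefficient of \<open>\<lambda>\<^sup>i\<mu>\<^sup>j\<close> in \<open>act (\<lambda>x + \<mu>y + z)\<^sup>m v\<close>.\<close>

primrec pencil ::
  "('a::ab_group_add \<Rightarrow> 'b::ab_group_add \<Rightarrow> 'b) \<Rightarrow> 'a \<Rightarrow> 'a \<Rightarrow> 'b \<Rightarrow> nat \<Rightarrow> nat \<Rightarrow> 'b" where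
  "pencil act x y v 0 = (\<lambda>i. if i = 0 then v else 0)"
| "pencil act x y v (Suc m) =
     (\<lambda>i. act y (pencil act x y v m i) + (case i of 0 \<Rightarrow> 0 | Suc k \<Rightarrow> act x (pencil act x y v m k)))"

primrec pencil2 ::
  "('a::ab_group_add \<Rightarrow> 'b::ab_group_add \<Rightarrow> 'b) \<Rightarrow> 'a \<Rightarrow> 'a \<Rightarrow> 'a \<Rightarrow> 'b \<Rightarrow> nat \<Rightarrow> nat \<Rightarrow> nat \<Rightarrow> 'b" where
  "pencil2 act x y z v 0 = (\<lambda>i j. if i = 0 \<and> j = 0 then v else 0)"
| "pencil2 act x y z v (Suc m) =
     (\<lambda>i j. act z (pencil2 act x y z v m i j)
       + (case i of 0 \<Rightarrow> 0 | Suc k \<Rightarrow> act x (pencil2 act x y z v m k j))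
       + (case j of 0 \<Rightarrow> 0 | Suc k \<Rightarrow> act y (pencil2 act x y z v m i k)))"

context
  fixes act :: "'a::ab_group_add \<Rightarrow> 'b::ab_group_add \<Rightarrow> 'b"
  assumes biadd: "biadditive act"
begin

interpretation biadditive act by (rule biadd)

lemma pencil_eq_0: "m < i \<Longrightarrow> pencil act x y v m i = 0"
  by (induction m arbitrary: i) (auto simp: zero split: nat.split)

lemma pencil_0: "pencil act x y v m 0 = (act y ^^ m) v"
  by (induction m) auto

lemma pencil_top: "pencil act x y v m m = (act x ^^ m) v"
  by (induction m) (auto simp: pencil_eq_0 zero)

text \<open>This is the substitution \<lambda> = 1.\<close>

lemma sum_pencil: "(\<Sum>i\<le>m. pencil act x y v m i) = (act (x + y) ^^ m) v"
proof (induction m)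
  case (Suc m)
  have "(\<Sum>i\<le>Suc m. pencil act x y v (Suc m) i) =
      (\<Sum>i\<le>Suc m. act y (pencil act x y v m i))
      + (\<Sum>i\<le>Suc m. case i of 0 \<Rightarrow> 0 | Suc k \<Rightarrow> act x (pencil act x y v m k))"
    by (simp only: pencil.simps sum.distrib)
  also have "(\<Sum>i\<le>Suc m. case i of 0 \<Rightarrow> 0 | Suc k \<Rightarrow> act x (pencil act x y v m k))
      = (\<Sum>i\<le>m. act x (pencil act x y v m i))"
    by (subst sum.atMost_Suc_shift) simp
  also have "(\<Sum>i\<le>Suc m. act y (pencil act x y v m i)) = (\<Sum>i\<le>m. act y (pencil act x y v m i))"
    by (simp add: pencil_eq_0 zero)
  finally show ?case
    by (simp only: right.sum[symmetric] Suc.IH add_left funpow.simps o_apply add.commute)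
qed simp

lemma pencil_add_start: "pencil act x y (v + v') m i = pencil act x y v m i + pencil act x y v' m i"
  by (induction m arbitrary: i) (auto simp: add_right split: nat.split)

lemma pencil_start_eq_0:
  assumes "act x v = 0" "act y v = 0" "m > 0"
  shows "pencil act x y v m i = 0"
proof -
  have "pencil act x y v (Suc m) i = 0" for m
    by (induction m arbitrary: i) (auto simp: assms zero split: nat.split)
  then show ?thesis
    using \<open>m > 0\<close> by (cases m) blast+
qed

lemma pencil2_eq_0: "m < i + j \<Longrightarrow> pencil2 act x y z v m i j = 0"
  by (induction m arbitrary: i j) (auto simp: zero split: nat.split)

lemma pencil2_swap: "pencil2 act x y z v m i j = pencil2 act y x z v m j i"
  by (induction m arbitrary: i j) (auto simp: add_ac split: nat.split)

lemma pencil2_left_0: "pencil2 act x y z v m 0 j = pencil act y z v m j"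
  by (induction m arbitrary: j) (auto split: nat.split)

text \<open>In top total degree every one of the \<open>m\<close> factors contributes \<lambda>x or
  \<mu>y, so \<open>z\<close> cannot occur.\<close>

lemma pencil2_top: "i \<le> m \<Longrightarrow> pencil2 act x y z v m i (m - i) = pencil act x y v m i"
proof (induction m arbitrary: i)
  case (Suc m)
  show ?case
  proof (cases "i = Suc m")
    case True
    then show ?thesis
      using Suc.IH[of m] by (simp add: pencil2_eq_0 pencil_eq_0 zero)
  next
    case False
    then have "i \<le> m" "Suc m - i = Suc (m - i)"
      using Suc.prems by auto
    then show ?thesis
      using Suc.IH[of i] Suc.IH[of "i - 1"]
      by (cases i) (auto simp: pencil2_eq_0 zero)
  qed
qed simp

text \<open>This is the substitution \<mu> = \<lambda>.\<close>

lemma sum_pencil2_antidiagonal: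
  "(\<Sum>i\<le>l. pencil2 act x y z v m i (l - i)) = pencil act (x + y) z v m l"
proof (induction m arbitrary: l)
  case 0
  have "(\<Sum>i\<le>l. if i = 0 \<and> l - i = 0 then v else 0) = (\<Sum>i\<in>{0}. if i = 0 \<and> l - i = 0 then v else 0)"
    by (rule sum.mono_neutral_right) auto
  then show ?case
    by (simp del: sum.delta sum.delta')
next
  case (Suc m)
  let ?W = "pencil2 act x y z v m"
  have x: "(\<Sum>i\<le>l. case i of 0 \<Rightarrow> 0 | Suc k \<Rightarrow> act x (?W k (l - i))) =
      (case l of 0 \<Rightarrow> 0 | Suc n \<Rightarrow> act x (pencil act (x + y) z v m n))"
    by (cases l) (simp_all only: sum.atMost_Suc_shift, simp_all add: Suc.IH[symmetric] right.sum)
  have "(\<Sum>i\<le>l. case l - i of 0 \<Rightarrow> 0 | Suc k \<Rightarrow> act y (?W i k)) =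
      (case l of 0 \<Rightarrow> 0 | Suc n \<Rightarrow> act y (pencil act (x + y) z v m n))"
    by (cases l) (auto simp: Suc.IH[symmetric] right.sum Suc_diff_le intro!: sum.cong)
  with x show ?case
    by (simp add: sum.distrib Suc.IH[symmetric] right.sum[symmetric] add_left add.assoc split: nat.split)
qed

text \<open>This is the substitution \<mu> = 1; the bound on \<open>n\<close> makes the sum contain
  all nonzero coefficients of the row.\<close>

lemma sum_pencil2_row:
  assumes "m \<le> i + n"
  shows "(\<Sum>j\<le>n. pencil2 act x y z v m i j) = pencil act x (y + z) v m i"
  using assms
proof (induction m arbitrary: i n)
  case 0
  then show ?case
    by (cases "i = 0") (auto simp: sum.delta)
next
  case (Suc m)
  let ?W = "pencil2 act x y z v m"
  have IH: "(\<Sum>j\<le>k. act u (?W i j)) = act u (pencil act x (y + z) v m i)" if "m \<le> i + k" for u i k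
    using Suc.IH[OF that] by (simp add: right.sum[symmetric])
  have x: "(\<Sum>j\<le>n. case i of 0 \<Rightarrow> 0 | Suc k \<Rightarrow> act x (?W k j)) =
      (case i of 0 \<Rightarrow> 0 | Suc k \<Rightarrow> act x (pencil act x (y + z) v m k))"
    using Suc.prems by (auto simp: IH split: nat.split)
  have y: "(\<Sum>j\<le>n. case j of 0 \<Rightarrow> 0 | Suc k \<Rightarrow> act y (?W i k)) = act y (pencil act x (y + z) v m i)"
  proof (cases n)
    case 0
    then show ?thesis
      using Suc.prems by (simp add: pencil_eq_0 zero)
  next
    case (Suc k)
    then show ?thesis
      using Suc.prems by (simp only: sum.atMost_Suc_shift, simp add: IH)
  qed
  have "(\<Sum>j\<le>n. act z (?W i j)) = act z (pencil act x (y + z) v m i)"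
    using Suc.prems by (simp add: IH)
  with x y show ?case
    by (simp add: sum.distrib add_left add_ac)
qed

end

section \<open>Jacobson terms as pencil coefficients, and the Leibniz expansions read off on
  coefficients\<close>

lemma coeff_poly_bracket_linear:
  assumes "biadditive br"
  shows "coeff (poly_bracket br [:y, x:] Q) n =
    br y (coeff Q n) + (case n of 0 \<Rightarrow> 0 | Suc k \<Rightarrow> br x (coeff Q k))"
proof -
  interpret biadditive br by fact
  have eq0: "br u (coeff Q j) = 0" if "\<not> j \<le> degree Q" for u j
    using that by (simp add: coeff_eq_0 zero)
  \<comment> \<open>For \<open>x = 0\<close> the polynomial \<open>[:y, x:]\<close> has smaller
    degree, so the range of \<open>i\<close> is enlarged to cover both cases at once.\<close>
  have "poly_bracket br [:y, x:] Q =
      (\<Sum>i\<le>Suc 0. \<Sum>j\<le>degree Q. monom (br (coeff [:y, x:] i) (coeff Q j)) (i + j))"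
    unfolding poly_bracket_def
    by (rule sum.mono_neutral_left) (auto simp: zero coeff_eq_0 intro!: sum.neutral)
  also have "coeff \<dots> n = (\<Sum>j\<le>degree Q. if j = n then br y (coeff Q j) else 0)
      + (\<Sum>j\<le>degree Q. if Suc j = n then br x (coeff Q j) else 0)"
    by (simp add: coeff_sum)
  also have "(\<Sum>j\<le>degree Q. if j = n then br y (coeff Q j) else 0) = br y (coeff Q n)"
    by (simp add: sum.delta eq0)
  also have "(\<Sum>j\<le>degree Q. if Suc j = n then br x (coeff Q j) else 0) =
      (case n of 0 \<Rightarrow> 0 | Suc k \<Rightarrow> br x (coeff Q k))"
    by (cases n) (auto simp: sum.delta eq0)
  finally show ?thesis .
qed

lemma jacobson_s_eq_pencil:
  assumes "biadditive br"
  shows "jacobson_s scale br p i x y =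
    scale (inverse (of_nat i)) (pencil br x y x (p - 1) (i - 1))"
proof -
  have "coeff ((poly_bracket br [:y, x:] ^^ m) [:v:]) = pencil br x y v m" for m v
    by (induction m) (auto simp: fun_eq_iff coeff_poly_bracket_linear[OF assms] coeff_pCons split: nat.split)
  then show ?thesis
    by (simp add: jacobson_s_def)
qed

text \<open>Closedness of \<open>ad_power_closed\<close>, read off on coefficients for \<open>a = \<lambda>x + \<mu>y + z\<close>.\<close>

lemma (in lie_ring) pencil2_closed:
  assumes "prime p" "\<And>u::'a. nat_mult p u = 0"
  shows "nat_mult (Suc j) (pencil2 br x y z x (p - 1) i (Suc j)) =
    nat_mult (Suc i) (pencil2 br x y z y (p - 1) (Suc i) j)"
proof -
  \<comment> \<open>This is \<lambda>x + \<mu>y + z, with \<lambda> the outer and \<mu> the inner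
    variable.\<close>
  define a where "a = Abs_fps (\<lambda>i. Abs_fps (\<lambda>j. if i = 0 \<and> j = 0 then z
    else if i = Suc 0 \<and> j = 0 then x else if i = 0 \<and> j = Suc 0 then y else 0))"
  let ?C = "fps_const \<circ> fps_const"
  interpret conv: lie_ring "conv br"
    by (rule lie_ring_conv) unfold_locales
  interpret conv2: lie_ring "conv (conv br)"
    by (rule lie_ring_conv) unfold_locales
  have add1: "biadditive (conv br)" and add2: "biadditive (conv (conv br))"
    by unfold_locales
  have "fps_nth (fps_nth (conv (conv br) a f) i) j = br z (fps_nth (fps_nth f i) j)
      + (case i of 0 \<Rightarrow> 0 | Suc k \<Rightarrow> br x (fps_nth (fps_nth f k) j))
      + (case j of 0 \<Rightarrow> 0 | Suc k \<Rightarrow> br y (fps_nth (fps_nth f i) k))" for f i j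
  proof -
    have "fps_nth a (Suc (Suc k)) = 0" for k
      by (simp add: a_def fps_eq_iff)
    moreover have "fps_nth (fps_nth a k) (Suc (Suc l)) = 0" for k l
      by (simp add: a_def)
    ultimately show ?thesis
      by (auto simp: conv_nth_linear[OF add1] conv_nth_linear[OF biadditive_axioms] a_def zero
          split: nat.split)
  qed
  then have pencil2: "fps_nth (fps_nth ((conv (conv br) a ^^ m) (?C v)) i) j = pencil2 br x y z v m i j"
    for m v i j
    by (induction m arbitrary: i j) (auto split: nat.split)
  let ?inner = "map_coeffs deriv_fps :: 'a fps fps \<Rightarrow> 'a fps fps"
  have "?inner ((conv (conv br) a ^^ (p - 1)) (?C x)) = deriv_fps ((conv (conv br) a ^^ (p - 1)) (?C y))"
  proof (rule conv2.ad_power_closed[OF assms(1)])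
    show "nat_mult p u = 0" for u :: "'a fps fps"
      by (simp add: fps_eq_iff assms(2))
    show "deriv_fps (conv (conv br) f g) = conv (conv br) (deriv_fps f) g + conv (conv br) f (deriv_fps g)" for f g
      by (rule deriv_fps_conv) unfold_locales
    show "deriv_fps a = ?C x" "deriv_fps (?C y) = 0"
      by (auto simp: fps_eq_iff deriv_fps_def a_def)
    show "?inner (conv (conv br) f g) = conv (conv br) (?inner f) g + conv (conv br) f (?inner g)" for f g
      by (rule map_coeffs_conv) (rule additive_deriv_fps, rule deriv_fps_conv, unfold_locales)
    show "?inner a = ?C y" "?inner (?C x) = 0"
      by (auto simp: fps_eq_iff deriv_fps_def map_coeffs_def a_def)
  qed
  then have "fps_nth (fps_nth (?inner ((conv (conv br) a ^^ (p - 1)) (?C x))) i) j =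
      fps_nth (fps_nth (deriv_fps ((conv (conv br) a ^^ (p - 1)) (?C y))) i) j"
    by simp
  then show ?thesis
    by (simp only: map_coeffs_def deriv_fps_def fps_nth_Abs_fps fps_nth_nat_mult pencil2)
qed

text \<open>The derivative with respect to \<open>\<lambda>\<close> of the \<open>p\<close>-th power of the operator \<open>act (\<lambda>x + y)\<close>.\<close>

lemma pencil_power_prime:
  fixes act :: "'a::ab_group_add \<Rightarrow> 'b::ab_group_add \<Rightarrow> 'b"
  assumes "prime p" "\<And>u::'b. nat_mult p u = 0" "biadditive act" "biadditive br"
    and leibniz: "\<And>a f g. act a (act f g) = act (br a f) g + act f (act a g)"
  shows "nat_mult (Suc i) (pencil act x y v p (Suc i)) = act (pencil br x y x (p - 1) i) v"
proof -
  define a where "a = Abs_fps (\<lambda>i. if i = 0 then y else if i = Suc 0 then x else 0)"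
  interpret act: biadditive act by fact
  interpret conv: biadditive "conv act" by (rule biadditive_conv) fact
  have a: "fps_nth a (Suc (Suc k)) = 0" "fps_nth a 0 = y" "fps_nth a (Suc 0) = x" for k
    by (simp_all add: a_def)
  have pencil: "fps_nth ((conv act a ^^ m) (fps_const v)) i = pencil act x y v m i" for m v i
    by (induction m arbitrary: i)
      (auto simp: conv_nth_linear[OF assms(3) a(1)] a split: nat.split)
  have pencil': "fps_nth ((conv br a ^^ m) (fps_const v)) i = pencil br x y v m i" for m v i
    by (induction m arbitrary: i)
      (auto simp: conv_nth_linear[OF assms(4) a(1)] a split: nat.split)
  have "deriv_fps ((conv act a ^^ p) (fps_const v)) =
      conv act ((conv br a ^^ (p - 1)) (fps_const x)) (fps_const v)"
  proof (rule deriv_power_prime[OF assms(1), where B = "conv act" and c = "conv act a"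
        and D = "conv br a" and \<delta> = deriv_fps and w = "fps_const x" and v = "fps_const v"])
    show "nat_mult p u = 0" for u :: "'b fps"
      by (simp add: fps_eq_iff assms(2))
    show "biadditive (conv act)" "additive (conv act a)"
      by unfold_locales
    show "conv act a (conv act f g) = conv act (conv br a f) g + conv act f (conv act a g)" for f g
      by (rule conv_leibniz) (fact assms)+
    have "deriv_fps a = fps_const x"
      by (auto simp: fps_eq_iff deriv_fps_def a_def)
    then show "deriv_fps (conv act a g) = conv act (fps_const x) g + conv act a (deriv_fps g)" for g
      by (simp add: deriv_fps_conv[OF assms(3)])
    show "deriv_fps (fps_const v) = 0"
      by (auto simp: fps_eq_iff deriv_fps_def)
  qed
  then have "fps_nth (deriv_fps ((conv act a ^^ p) (fps_const v))) i =
      fps_nth (conv act ((conv br a ^^ (p - 1)) (fps_const x)) (fps_const v)) i"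
    by simp
  moreover have "fps_nth (conv act f (fps_const v)) i = act (fps_nth f i) v" for f
    by (cases i) (auto simp: conv_def act.zero)
  ultimately show ?thesis
    by (simp add: deriv_fps_def pencil pencil')
qed

subsection \<open>The Jacobson cocycle\<close>

lemma power_add_prime_char:
  fixes a b :: "'k::comm_ring_1"
  assumes "prime p" "CHAR('k) = p"
  shows "(a + b) ^ p = a ^ p + b ^ p"
proof -
  let ?t = "\<lambda>k. of_nat (p choose k) * a ^ k * b ^ (p - k)"
  have "p > 0"
    using \<open>prime p\<close> by (rule prime_gt_0_nat)
  have "?t k = 0" if "k \<in> {..p} - {0, p}" for k
    using that dvd_choose_prime[of k p] assms \<open>p > 0\<close> by (auto simp: of_nat_eq_0_iff_char_dvd)
  then have "(\<Sum>k\<le>p. ?t k) = (\<Sum>k\<in>{0, p}. ?t k)"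
    by (intro sum.mono_neutral_right) auto
  then show ?thesis
    using \<open>p > 0\<close> by (simp add: binomial_ring add.commute)
qed

lemma (in vector_space) nat_mult_eq_scale: "nat_mult n x = scale (of_nat n) x"
  by (induction n) (simp_all add: nat_mult_Suc scale_left_distrib add.commute)

text \<open>The bound \<open>p > 2\<close> makes 2 invertible, so antisymmetry implies the
  alternating law \<open>br_self\<close>.\<close>

locale char_p_lie_algebra = vector_space scale + lie_ring br
  for scale :: "'k::field \<Rightarrow> 'l::ab_group_add \<Rightarrow> 'l" and br :: "'l \<Rightarrow> 'l \<Rightarrow> 'l" +
  fixes p :: nat
  assumes char_eq: "CHAR('k) = p" and char_gt_2: "p > 2"
    and br_scale_left: "br (scale c x) y = scale c (br x y)"
    and br_scale_right: "br x (scale c y) = scale c (br x y)"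
begin

lemma prime_p: "prime p"
  using prime_CHAR_semidom[where 'a='k] char_eq char_gt_2 by simp

lemma of_nat_eq_0_iff: "of_nat n = (0::'k) \<longleftrightarrow> p dvd n"
  by (simp add: of_nat_eq_0_iff_char_dvd char_eq)

lemma of_nat_neq_0: "0 < n \<Longrightarrow> n < p \<Longrightarrow> of_nat n \<noteq> (0::'k)"
  by (auto simp: of_nat_eq_0_iff dest: dvd_imp_le)

lemma scale_inverse_of_nat:
  assumes "0 < n" "n < p"
  shows "scale (inverse (of_nat n)) (scale (of_nat n) x) = x"
  using of_nat_neq_0[OF assms] by simp

lemma nat_mult_p: "nat_mult p (u::'l) = 0"
  by (simp add: nat_mult_eq_scale of_nat_eq_0_iff)

lemma br_self: "br x x = 0"
proof -
  have "scale (of_nat 2) (br x x) = br x x + br x x"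
    using scale_left_distrib[of 1 1 "br x x"] by simp
  also have "\<dots> = 0"
    using antisym[of x x] by (simp add: eq_neg_iff_add_eq_0)
  finally show ?thesis
    using of_nat_neq_0[of 2] char_gt_2 by simp
qed

definition jacobson :: "'l \<Rightarrow> 'l \<Rightarrow> 'l" where
  "jacobson x y = (\<Sum>i=1..p-1. jacobson_s scale br p i x y)"

lemma jacobson_eq_pencil:
  "jacobson x y = (\<Sum>i=1..p-1. scale (inverse (of_nat i)) (pencil br x y x (p - 1) (i - 1)))"
  by (simp add: jacobson_def jacobson_s_eq_pencil[OF biadditive_axioms])

lemma pencil_scale:
  "pencil br (scale c x) (scale c y) (scale c v) m i = scale (c ^ Suc m) (pencil br x y v m i)"
  by (induction m arbitrary: i)
    (auto simp: br_scale_left br_scale_right scale_right_distrib mult_ac split: nat.split)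

lemma jacobson_scale: "jacobson (scale c x) (scale c y) = scale (c ^ p) (jacobson x y)"
  using char_gt_2
  by (simp add: jacobson_eq_pencil pencil_scale scale_sum_right mult.commute
      del: power_Suc flip: power_Suc)

text \<open>Both multiples of \<open>x\<close> annihilate the starting vector. Hence the multiples
  of a single basis vector add without correction term.\<close>

lemma jacobson_collinear: "jacobson (scale a x) (scale b x) = 0"
proof -
  have "pencil br (scale a x) (scale b x) (scale a x) (p - 1) i = 0" for i
    using char_gt_2
    by (intro pencil_start_eq_0[OF biadditive_axioms])
      (simp_all add: br_scale_left br_scale_right br_self)
  then show ?thesis
    by (simp add: jacobson_eq_pencil)
qed

text \<open>For \<open>i + j + k = p\<close>, the component of degree \<open>i\<close> in \<open>x\<close>, \<open>j\<close> in \<open>y\<close> and \<open>k\<close> in \<open>z\<close> of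
  the formal expression \<open>(x + y + z)\<^sup>p\<close>.\<close>

definition component :: "'l \<Rightarrow> 'l \<Rightarrow> 'l \<Rightarrow> nat \<Rightarrow> nat \<Rightarrow> 'l" where
  "component x y z i j =
     (if i > 0 then scale (inverse (of_nat i)) (pencil2 br x y z x (p - 1) (i - 1) j)
      else scale (inverse (of_nat j)) (pencil2 br x y z y (p - 1) i (j - 1)))"

lemma scale_component_left:
  assumes "i < p"
  shows "scale (of_nat i) (component x y z i j) =
    (if i = 0 then 0 else pencil2 br x y z x (p - 1) (i - 1) j)"
  using assms of_nat_neq_0[of i] by (simp add: component_def)

text \<open>Although \<open>component\<close> integrates along \<open>x\<close> when
  \<open>i > 0\<close>, closedness of the one-form shows that integrating along \<open>y\<close>
  gives the same element.\<close>

lemma scale_component_right: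
  assumes "i < p" "j < p"
  shows "scale (of_nat j) (component x y z i j) =
    (if j = 0 then 0 else pencil2 br x y z y (p - 1) i (j - 1))"
proof (cases "i = 0 \<or> j = 0")
  case True
  then show ?thesis
    using assms of_nat_neq_0[of j] by (auto simp: component_def)
next
  case False
  then obtain i' j' where "i = Suc i'" "j = Suc j'"
    by (metis not0_implies_Suc)
  then have "scale (of_nat j) (pencil2 br x y z x (p - 1) (i - 1) j) =
      scale (of_nat i) (pencil2 br x y z y (p - 1) i (j - 1))"
    using pencil2_closed[OF prime_p nat_mult_p, of j' x y z i'] by (simp only: nat_mult_eq_scale diff_Suc_1)
  moreover have "scale (of_nat j) (component x y z i j) =
      scale (inverse (of_nat i)) (scale (of_nat j) (pencil2 br x y z x (p - 1) (i - 1) j))"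
    using False by (simp add: component_def mult.commute)
  ultimately show ?thesis
    using False assms of_nat_neq_0[of i] by simp
qed

text \<open>Since the degrees in \<open>x\<close> and \<open>y\<close> add up to \<open>p\<close>,
  the component does not involve \<open>z\<close>, which may therefore be chosen freely.\<close>

lemma jacobson_eq_component: "jacobson x y = (\<Sum>i=1..p-1. component x y z i (p - i))"
  unfolding jacobson_eq_pencil
proof (intro sum.cong refl)
  fix i assume "i \<in> {1..p - 1}"
  then show "scale (inverse (of_nat i)) (pencil br x y x (p - 1) (i - 1)) = component x y z i (p - i)"
    using pencil2_top[OF biadditive_axioms, of "i - 1" "p - 1" x y z x] by (auto simp: component_def)
qed

lemma jacobson_commute: "jacobson x y = jacobson y x"
proof -
  have "jacobson x y = (\<Sum>i=1..p-1. component x y 0 (p - i) i)"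
    unfolding jacobson_eq_component[of x y 0]
    by (rule sum.reindex_bij_witness[of _ "\<lambda>i. p - i" "\<lambda>i. p - i"]) auto
  also have "\<dots> = jacobson y x"
    unfolding jacobson_eq_pencil
  proof (intro sum.cong refl)
    fix i assume "i \<in> {1..p - 1}"
    then have i: "0 < i" "i < p"
      by auto
    have "scale (of_nat i) (component x y 0 (p - i) i) = pencil2 br y x 0 y (p - 1) (i - 1) (p - i)"
      using i by (subst scale_component_right) (auto simp: pencil2_swap[OF biadditive_axioms, of x])
    also have "\<dots> = pencil br y x y (p - 1) (i - 1)"
      using pencil2_top[OF biadditive_axioms, of "i - 1" "p - 1" y x 0 y] i by simp
    finally show "component x y 0 (p - i) i = scale (inverse (of_nat i)) (pencil br y x y (p - 1) (i - 1))"
      using scale_inverse_of_nat[OF i, of "component x y 0 (p - i) i"] by (simp only:)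
  qed
  finally show ?thesis .
qed

lemma jacobson_add_left:
  "jacobson (x + y) z = (\<Sum>l=1..p-1. \<Sum>i\<le>l. component x y z i (l - i))"
  unfolding jacobson_eq_pencil
proof (intro sum.cong refl)
  fix l assume "l \<in> {1..p - 1}"
  then obtain n where n: "l = Suc n" "l < p"
    by (cases l) auto
  let ?T = "component x y z"
  \<comment> \<open>Writing \<open>l\<close> as \<open>i + (l - i)\<close> turns each component into
    its derivatives along \<open>x\<close> and \<open>y\<close>, which are sums over antidiagonals.
    Division by \<open>l\<close> is possible because \<open>0 < l < p\<close>.\<close>
  have "scale (of_nat l) (\<Sum>i\<le>l. ?T i (l - i)) =
      (\<Sum>i\<le>l. scale (of_nat i) (?T i (l - i)) + scale (of_nat (l - i)) (?T i (l - i)))"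
    by (simp add: scale_sum_right scale_left_distrib[symmetric] of_nat_diff del: sum.atMost_Suc)
  also have "\<dots> = (\<Sum>i\<le>l. if i = 0 then 0 else pencil2 br x y z x (p - 1) (i - 1) (l - i))
      + (\<Sum>i\<le>l. if l - i = 0 then 0 else pencil2 br x y z y (p - 1) i (l - i - 1))"
    unfolding sum.distrib[symmetric] using n
    by (intro sum.cong refl arg_cong2[where f="(+)"] scale_component_left scale_component_right) auto
  also have "(\<Sum>i\<le>l. if i = 0 then 0 else pencil2 br x y z x (p - 1) (i - 1) (l - i)) =
      (\<Sum>i\<le>n. pencil2 br x y z x (p - 1) i (n - i))"
    unfolding n(1) by (subst sum.atMost_Suc_shift) simp
  also have "(\<Sum>i\<le>l. if l - i = 0 then 0 else pencil2 br x y z y (p - 1) i (l - i - 1)) =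
      (\<Sum>i\<le>n. pencil2 br x y z y (p - 1) i (n - i))"
    unfolding n(1) by (simp add: Suc_diff_le)
  finally have "scale (of_nat l) (\<Sum>i\<le>l. ?T i (l - i)) = pencil br (x + y) z (x + y) (p - 1) (l - 1)"
    by (simp add: sum_pencil2_antidiagonal[OF biadditive_axioms] pencil_add_start[OF biadditive_axioms] n)
  from this[symmetric] show "scale (inverse (of_nat l)) (pencil br (x + y) z (x + y) (p - 1) (l - 1)) =
      (\<Sum>i\<le>l. ?T i (l - i))"
    using n by (simp only: scale_inverse_of_nat zero_less_Suc)
qed

lemma jacobson_add_right:
  "jacobson x (y + z) = (\<Sum>i=1..p-1. \<Sum>j\<le>p-i. component x y z i j)"
  unfolding jacobson_eq_pencil
proof (intro sum.cong refl)
  fix i assume "i \<in> {1..p - 1}"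
  then show "scale (inverse (of_nat i)) (pencil br x (y + z) x (p - 1) (i - 1)) =
      (\<Sum>j\<le>p - i. component x y z i j)"
    by (auto simp: component_def scale_sum_right[symmetric] sum_pencil2_row[OF biadditive_axioms])
qed

text \<open>Both sides sum the components over all degree triples with total \<open>p\<close>,
  except the three pure powers. On the left the triples are sorted by the degree in
  \<open>z\<close>, on the right by the degree in \<open>x\<close>.\<close>

lemma jacobson_cocycle: "jacobson x y + jacobson (x + y) z = jacobson y z + jacobson x (y + z)"
proof -
  let ?T = "component x y z"
  have "(\<Sum>l=1..p-1. \<Sum>i\<le>l. ?T i (l - i)) = (\<Sum>l=1..p-1. ?T 0 l + (\<Sum>i=1..l. ?T i (l - i)))"
    by (intro sum.cong refl) (simp add: sum.atMost_shift sum.atLeast1_atMost_eq)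
  also have "(\<Sum>l=1..p-1. ?T 0 l + (\<Sum>i=1..l. ?T i (l - i))) =
      jacobson y z + (\<Sum>l=1..p-1. \<Sum>i=1..l. ?T i (l - i))"
    by (simp add: sum.distrib jacobson_eq_pencil component_def pencil2_left_0[OF biadditive_axioms])
  also have "(\<Sum>l=1..p-1. \<Sum>i=1..l. ?T i (l - i)) = (\<Sum>i=1..p-1. \<Sum>j<p-i. ?T i j)"
    unfolding sum.Sigma[OF finite_atLeastAtMost ballI[OF finite_atLeastAtMost]]
      sum.Sigma[OF finite_atLeastAtMost ballI[OF finite_lessThan]]
    by (rule sum.reindex_bij_witness[of _ "\<lambda>(i, j). (i + j, i)" "\<lambda>(l, i). (i, l - i)"]) auto
  finally have "jacobson x y + jacobson (x + y) z =
      jacobson y z + (\<Sum>i=1..p-1. (\<Sum>j<p-i. ?T i j) + ?T i (p - i))"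
    by (simp add: jacobson_add_left jacobson_eq_component[of x y z] sum.distrib)
  also have "(\<Sum>i=1..p-1. (\<Sum>j<p-i. ?T i j) + ?T i (p - i)) = jacobson x (y + z)"
    by (simp add: jacobson_add_right lessThan_Suc_atMost[symmetric])
  finally show ?thesis .
qed

lemma jacobson_zero [simp]: "jacobson 0 x = 0" "jacobson x 0 = 0"
  using jacobson_collinear[of 0 x 1] jacobson_collinear[of 1 x 0] by simp_all

text \<open>The abelian extension of the additive group by itself that is defined by the cocycle; a
  \<open>p\<close>-map is a \<open>p\<close>-semilinear section of it.\<close>

definition ext_add :: "'l \<times> 'l \<Rightarrow> 'l \<times> 'l \<Rightarrow> 'l \<times> 'l" where
  "ext_add a b = (fst a + fst b, snd a + snd b + jacobson (fst a) (fst b))"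

sublocale ext: comm_monoid_set ext_add "(0, 0)"
proof
  fix a b c :: "'l \<times> 'l"
  show "ext_add (ext_add a b) c = ext_add a (ext_add b c)"
    using jacobson_cocycle[of "fst a" "fst b" "fst c"] by (simp add: ext_add_def add_ac)
  show "ext_add a b = ext_add b a"
    by (simp add: ext_add_def jacobson_commute[of "fst a"] add.commute)
  show "ext_add a (0, 0) = a"
    by (simp add: ext_add_def)
qed

text \<open>The pairs \<open>(b, y b)\<close> are extended semilinearly, with sums taken in the
  extension. The first coordinate recovers the vector, the second is the desired map.\<close>

lemma semilinear_section:
  assumes "independent B"
  shows "\<exists>f. (\<forall>x\<in>span B. \<forall>x'\<in>span B. f (x + x') = f x + f x' + jacobson x x')
    \<and> (\<forall>x\<in>span B. \<forall>c. f (scale c x) = scale (c ^ p) (f x))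
    \<and> (\<forall>b\<in>B. f b = y b)"
proof -
  have p: "0 < p" using char_gt_2 by simp
  \<comment> \<open>The multiple by \<open>r\<close> of \<open>(b, y b)\<close>, where scalars act
    on the second coordinate through their \<open>p\<close>-th powers.\<close>
  define t where "t = (\<lambda>r b. (scale r b, scale (r ^ p) (y b)))"
  define S where "S = (\<lambda>x. {b. representation B x b \<noteq> 0})"
  define F where "F = (\<lambda>x. ext.F (\<lambda>b. t (representation B x b) b) (S x))"
  have fin: "finite (S x)" for x
    by (simp add: S_def finite_representation)
  have t_0: "t 0 b = (0, 0)" for b
    using p by (simp add: t_def)
  have F_eq: "F x = ext.F (\<lambda>b. t (representation B x b) b) A" if "finite A" "S x \<subseteq> A" for x A
    unfolding F_def using that by (intro ext.mono_neutral_left) (auto simp: S_def t_0)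
  have fst_F: "fst (F x) = x" if "x \<in> span B" for x
  proof -
    have "fst (ext.F g A) = (\<Sum>b\<in>A. fst (g b))" if "finite A" for g and A :: "'l set"
      using that by induction (auto simp: ext_add_def)
    then have "fst (F x) = (\<Sum>b\<in>S x. scale (representation B x b) b)"
      by (simp add: F_def fin t_def)
    then show ?thesis
      using sum_nonzero_representation_eq[OF assms that] by (simp add: S_def)
  qed
  have F_add: "F (x + z) = ext_add (F x) (F z)" if "x \<in> span B" "z \<in> span B" for x z
  proof -
    let ?A = "S x \<union> S z"
    have r: "representation B (x + z) b = representation B x b + representation B z b" for b
      using representation_add[OF assms that(2,1)] by (simp add: add.commute)
    have "F (x + z) = ext.F (\<lambda>b. t (representation B (x + z) b) b) ?A"
      by (intro F_eq) (auto simp: fin[unfolded S_def] S_def r)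
    \<comment> \<open>For fixed \<open>b\<close> the map \<open>t\<close> is additive in the scalar:
      collinear vectors have no Jacobson term and the Frobenius map is additive.\<close>
    also have "\<dots> = ext.F (\<lambda>b. ext_add (t (representation B x b) b) (t (representation B z b) b)) ?A"
      by (simp add: r t_def ext_add_def jacobson_collinear scale_left_distrib
          power_add_prime_char[OF prime_p char_eq])
    also have "\<dots> = ext_add (F x) (F z)"
      by (simp add: ext.distrib F_eq[of ?A] fin)
    finally show ?thesis .
  qed
  have F_scale: "F (scale c x) = (scale c (fst (F x)), scale (c ^ p) (snd (F x)))" if "x \<in> span B" for c x
  proof -
    \<comment> \<open>By \<open>jacobson_scale\<close>, this scaling is an endomorphism of the
      extension and commutes with finite sums.\<close>
    have hom: "ext.F (\<lambda>b. (scale c (fst (g b)), scale (c ^ p) (snd (g b)))) A =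
        (scale c (fst (ext.F g A)), scale (c ^ p) (snd (ext.F g A)))" if "finite A" for g and A :: "'l set"
      using that by induction (simp_all add: ext_add_def scale_right_distrib jacobson_scale)
    have r: "representation B (scale c x) b = c * representation B x b" for b
      using representation_scale[OF assms that] by simp
    have "F (scale c x) = ext.F (\<lambda>b. t (c * representation B x b) b) (S x)"
      unfolding r[symmetric] by (intro F_eq) (auto simp: fin[unfolded S_def] S_def r)
    also have "\<dots> = ext.F (\<lambda>b. (scale c (fst (t (representation B x b) b)),
        scale (c ^ p) (snd (t (representation B x b) b)))) (S x)"
      by (simp add: t_def power_mult_distrib)
    finally show ?thesis
      by (simp only: hom[OF fin]) (simp add: F_def)
  qed
  have F_base: "F b = (b, y b)" if "b \<in> B" for b
    using F_eq[of "{b}" b] representation_basis[OF assms that]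
    by (simp add: S_def t_def ext_add_def split: if_splits)
  show ?thesis
  proof (intro exI[of _ "\<lambda>x. snd (F x)"] conjI ballI allI)
    fix x z assume "x \<in> span B" "z \<in> span B"
    then show "snd (F (x + z)) = snd (F x) + snd (F z) + jacobson x z"
      using fst_F[of x] fst_F[of z] by (simp add: F_add ext_add_def)
  qed (simp_all add: F_scale F_base)
qed

end

text \<open>Integrating \<open>pencil_power_prime\<close> identifies the middle coefficients of the
  \<open>p\<close>-th power of \<open>act (\<lambda>x + y)\<close>; the extreme ones are the two
  pure powers. Keeping \<open>act\<close> apart from \<open>br\<close> covers an action on a larger
  space than the Lie algebra itself.\<close>

lemma (in char_p_lie_algebra) act_jacobson:
  assumes "biadditive act"
    and leibniz: "\<And>a f g. act a (act f g) = act (br a f) g + act f (act a g)"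
    and act_scale: "\<And>c x v. act (scale c x) v = scale c (act x v)"
  shows "(act (x + y) ^^ p) v = (act x ^^ p) v + (act y ^^ p) v + act (jacobson x y) v"
proof -
  interpret act: biadditive act by fact
  obtain n where n: "p = Suc n"
    using char_gt_2 by (cases p) auto
  have "pencil act x y v p i = scale (inverse (of_nat i)) (act (pencil br x y x (p - 1) (i - 1)) v)"
    if "i \<in> {1..p - 1}" for i
  proof -
    have "scale (of_nat i) (pencil act x y v p i) = act (pencil br x y x (p - 1) (i - 1)) v"
      using pencil_power_prime[OF prime_p nat_mult_p assms(1) biadditive_axioms leibniz, of "i - 1" x y v] that
      by (simp add: nat_mult_eq_scale)
    moreover have "scale (inverse (of_nat i)) (scale (of_nat i) (pencil act x y v p i)) = pencil act x y v p i"
      using that by (intro scale_inverse_of_nat) auto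
    ultimately show ?thesis
      by simp
  qed
  then have jacobson: "act (jacobson x y) v = (\<Sum>i=1..p-1. pencil act x y v p i)"
    by (simp add: jacobson_eq_pencil act.left.sum act_scale)
  have "(act (x + y) ^^ p) v = (\<Sum>i\<le>p. pencil act x y v p i)"
    by (rule sum_pencil[OF assms(1), symmetric])
  also have "\<dots> = pencil act x y v p 0 + (\<Sum>i=1..p-1. pencil act x y v p i) + pencil act x y v p p"
    unfolding n sum.atMost_Suc
    unfolding sum.atMost_shift by (simp add: sum.atLeast1_atMost_eq)
  finally show ?thesis
    by (simp add: pencil_0[OF assms(1)] pencil_top[OF assms(1)] jacobson add_ac)
qed

subsection \<open>Color algebras\<close>

context lie_color_algebra
begin

lemma subspace_L: "subspace (L \<gamma>)"
  using graded by (simp add: grading_def)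

lemma span_L: "span (\<Union>\<gamma>. L \<gamma>) = UNIV"
proof -
  have "x \<in> span (\<Union>\<gamma>. L \<gamma>)" for x
  proof -
    obtain c where c: "\<And>\<gamma>. c \<gamma> \<in> L \<gamma>" "x = (\<Sum>\<gamma> | c \<gamma> \<noteq> 0. c \<gamma>)"
      using graded unfolding grading_def by metis
    show ?thesis
      unfolding c(2) using c(1) by (intro span_sum span_base) auto
  qed
  then show ?thesis
    by auto
qed

sublocale bracket: biadditive bracket
  using linear_left linear_right by unfold_locales (simp_all add: Vector_Spaces.linear_iff)

lemma bracket_scale_left: "bracket (scale c x) y = scale c (bracket x y)"
  using linear_left by (simp add: Vector_Spaces.linear_iff)

lemma bracket_scale_right: "bracket x (scale c y) = scale c (bracket x y)"
  using linear_right by (simp add: Vector_Spaces.linear_iff)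

text \<open>Antisymmetry rewrites two terms of the Jacobi identity; what remains has the nonzero
  common factor \<open>\<epsilon> \<gamma> \<alpha>\<close>.\<close>

lemma color_leibniz:
  assumes "x \<in> L \<alpha>" "y \<in> L \<beta>" "z \<in> L \<gamma>"
  shows "bracket x (bracket y z) =
    bracket (bracket x y) z + scale (\<epsilon> \<alpha> \<beta>) (bracket y (bracket x z))"
proof -
  have "bracket z (bracket x y) = - scale (\<epsilon> \<gamma> (\<alpha> + \<beta>)) (bracket (bracket x y) z)"
    by (rule color_antisym) (auto intro: assms bracket_degree)
  moreover have "bracket z x = - scale (\<epsilon> \<gamma> \<alpha>) (bracket x z)"
    by (rule color_antisym) (auto intro: assms)
  ultimately have "scale (\<epsilon> \<gamma> \<alpha>) (bracket x (bracket y z)) =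
      scale (\<epsilon> \<alpha> \<beta> * \<epsilon> \<gamma> \<alpha>) (bracket y (bracket x z))
      + scale (\<epsilon> \<beta> \<gamma> * (\<epsilon> \<gamma> \<alpha> * \<epsilon> \<gamma> \<beta>)) (bracket (bracket x y) z)"
    using color_jacobi[OF assms]
    by (simp add: bracket.right.minus bracket_scale_right add_right algebra_simps)
  also have "\<epsilon> \<beta> \<gamma> * (\<epsilon> \<gamma> \<alpha> * \<epsilon> \<gamma> \<beta>) = \<epsilon> \<gamma> \<alpha>"
    using symmetric[of \<beta> \<gamma>] by (simp add: algebra_simps)
  finally have "scale (\<epsilon> \<gamma> \<alpha>) (bracket x (bracket y z)) =
      scale (\<epsilon> \<gamma> \<alpha>) (bracket (bracket x y) z + scale (\<epsilon> \<alpha> \<beta>) (bracket y (bracket x z)))"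
    by (simp add: scale_right_distrib mult.commute add.commute)
  then show ?thesis
    using nonzero[of \<gamma> \<alpha>] by simp
qed

lemma \<epsilon>_nat_mult:
  assumes "\<gamma> \<in> G_plus \<epsilon>"
  shows "\<epsilon> (nat_mult m \<gamma>) (nat_mult n \<gamma>) = 1"
proof -
  have "\<epsilon> 0 \<beta> = 1" "\<epsilon> \<beta> 0 = 1" for \<beta>
    using add_left[of 0 0 \<beta>] add_right[of \<beta> 0 0] nonzero by simp_all
  moreover from this have "\<epsilon> \<gamma> (nat_mult n \<gamma>) = 1"
    using assms by (induction n) (auto simp: nat_mult_Suc add_right G_plus_def)
  ultimately show ?thesis
    by (induction m) (auto simp: nat_mult_Suc add_left)
qed

section \<open>The ordinary Lie algebra generated by the degrees that are multiples of
  \<gamma>\<close>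

definition cyclic_part :: "'g \<Rightarrow> 'l set" where
  "cyclic_part \<gamma> = span (\<Union>n. L (nat_mult n \<gamma>))"

lemma subspace_cyclic_part: "subspace (cyclic_part \<gamma>)"
  by (simp add: cyclic_part_def)

lemma L_subset_cyclic_part: "L (nat_mult n \<gamma>) \<subseteq> cyclic_part \<gamma>"
  unfolding cyclic_part_def by (meson UN_upper UNIV_I span_superset subset_trans)

lemma bracket_cyclic_part:
  assumes "x \<in> cyclic_part \<gamma>" "y \<in> cyclic_part \<gamma>"
  shows "bracket x y \<in> cyclic_part \<gamma>"
  using assms(1) unfolding cyclic_part_def
proof (induction rule: span_induct_alt)
  case (step c x x')
  then obtain m where x: "x \<in> L (nat_mult m \<gamma>)"
    by auto
  have "bracket x y \<in> span (\<Union>n. L (nat_mult n \<gamma>))"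
    using assms(2) unfolding cyclic_part_def
  proof (induction rule: span_induct_alt)
    case (step d y y')
    then obtain n where "y \<in> L (nat_mult n \<gamma>)"
      by auto
    then have "bracket x y \<in> L (nat_mult (m + n) \<gamma>)"
      using x by (simp add: nat_mult_add_left bracket_degree)
    then have "bracket x y \<in> span (\<Union>n. L (nat_mult n \<gamma>))"
      by (intro span_base) auto
    with step.IH show ?case
      by (simp add: bracket.add_right bracket_scale_right span_add span_scale)
  qed (simp add: bracket.zero span_zero)
  with step.IH show ?case
    by (simp add: bracket.add_left bracket_scale_left span_add span_scale)
qed (simp add: bracket.zero span_zero)

lemma antisym_cyclic_part:
  assumes "\<gamma> \<in> G_plus \<epsilon>" "x \<in> cyclic_part \<gamma>" "y \<in> cyclic_part \<gamma>"
  shows "bracket x y = - bracket y x"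
  using assms(2) unfolding cyclic_part_def
proof (induction rule: span_induct_alt)
  case (step c x x')
  then obtain m where x: "x \<in> L (nat_mult m \<gamma>)"
    by auto
  have "bracket x y = - bracket y x"
    using assms(3) unfolding cyclic_part_def
  proof (induction rule: span_induct_alt)
    case (step d y y')
    then obtain n where "y \<in> L (nat_mult n \<gamma>)"
      by auto
    with x have "bracket x y = - bracket y x"
      using color_antisym[of x "nat_mult m \<gamma>" y "nat_mult n \<gamma>"] by (simp add: \<epsilon>_nat_mult[OF assms(1)])
    with step.IH show ?case
      by (simp add: bracket.add_left bracket.add_right bracket_scale_left bracket_scale_right)
  qed (simp add: bracket.zero)
  with step.IH show ?case
    by (simp add: bracket.add_left bracket.add_right bracket_scale_left bracket_scale_right)
qed (simp add: bracket.zero)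

text \<open>Only the degrees of \<open>x\<close> and \<open>y\<close> enter the color factor, so
  \<open>z\<close> may range over the whole algebra: the cyclic part acts on all of it by ordinary
  derivation rules.\<close>

lemma leibniz_cyclic_part:
  assumes "\<gamma> \<in> G_plus \<epsilon>" "x \<in> cyclic_part \<gamma>" "y \<in> cyclic_part \<gamma>"
  shows "bracket x (bracket y z) = bracket (bracket x y) z + bracket y (bracket x z)"
  using assms(2) unfolding cyclic_part_def
proof (induction rule: span_induct_alt)
  case (step c x x')
  then obtain m where x: "x \<in> L (nat_mult m \<gamma>)"
    by auto
  have "bracket x (bracket y z) = bracket (bracket x y) z + bracket y (bracket x z)"
    using assms(3) unfolding cyclic_part_def
  proof (induction rule: span_induct_alt)
    case (step d y y')
    then obtain n where y: "y \<in> L (nat_mult n \<gamma>)"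
      by auto
    have "z \<in> span (\<Union>\<gamma>. L \<gamma>)"
      by (simp add: span_L)
    then have "bracket x (bracket y z) = bracket (bracket x y) z + bracket y (bracket x z)"
    proof (induction rule: span_induct_alt)
      case (step d z z')
      then obtain \<delta> where "z \<in> L \<delta>"
        by auto
      then have "bracket x (bracket y z) = bracket (bracket x y) z + bracket y (bracket x z)"
        using color_leibniz[OF x y] by (simp add: \<epsilon>_nat_mult[OF assms(1)])
      with step.IH show ?case
        by (simp add: bracket.add_right bracket_scale_right scale_right_distrib)
    qed (simp add: bracket.zero)
    with step.IH show ?case
      by (simp add: bracket.add_left bracket.add_right bracket_scale_left bracket_scale_right
          scale_right_distrib)
  qed (simp add: bracket.zero)
  with step.IH show ?case
    by (simp add: bracket.add_left bracket.add_right bracket_scale_left bracket_scale_right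
        scale_right_distrib)
qed (simp add: bracket.zero)

lemma pencil_degree:
  assumes "x \<in> L \<gamma>" "y \<in> L \<gamma>" "v \<in> L \<gamma>"
  shows "pencil bracket x y v m i \<in> L (nat_mult (Suc m) \<gamma>)"
proof (induction m arbitrary: i)
  case 0
  then show ?case
    using assms subspace_0[OF subspace_L] by simp
next
  case (Suc m)
  have "bracket u (pencil bracket x y v m i) \<in> L (nat_mult (Suc (Suc m)) \<gamma>)" if "u \<in> L \<gamma>" for u i
    using bracket_degree[OF that Suc] by (simp add: nat_mult_Suc add_ac)
  then show ?case
    using assms subspace_0[OF subspace_L] by (auto intro!: subspace_add[OF subspace_L] split: nat.split)
qed

text \<open>Since \<open>\<epsilon>\<close> is trivial on the multiples of \<open>\<gamma> \<in> G\<^sub>+\<close>, the cyclic part is an ordinary Lie algebra.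
  Its bracket becomes total by composition with any linear projection onto the cyclic part.\<close>

lemma pmap_component:
  assumes p: "CHAR('k) = p" "p > 2" and \<gamma>: "\<gamma> \<in> G_plus \<epsilon>"
    and basis: "indexed_basis (L \<gamma>) J e"
    and y_degree: "\<And>j. j \<in> J \<Longrightarrow> y j \<in> L (nat_mult p \<gamma>)"
    and y_ad: "\<And>j. j \<in> J \<Longrightarrow> bracket (e j) ^^ p = bracket (y j)"
  shows "\<exists>f. f \<in> L \<gamma> \<rightarrow> L (nat_mult p \<gamma>)
    \<and> (\<forall>x\<in>L \<gamma>. \<forall>a. f (scale a x) = scale (a ^ p) (f x))
    \<and> (\<forall>x\<in>L \<gamma>. \<forall>v. bracket (f x) v = (bracket x ^^ p) v)
    \<and> (\<forall>x\<in>L \<gamma>. \<forall>x'\<in>L \<gamma>. f (x + x') = f x + f x' + (\<Sum>i=1..p-1. jacobson_s scale bracket p i x x'))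
    \<and> (\<forall>j\<in>J. f (e j) = y j)"
proof -
  let ?H = "cyclic_part \<gamma>"
  interpret pair: vector_space_pair scale scale ..
  have "Vector_Spaces.linear scale scale (\<lambda>x. x)"
    by (rule linear_ident)
  then obtain \<pi> where \<pi>: "Vector_Spaces.linear scale scale \<pi>" "range \<pi> \<subseteq> ?H" "\<And>x. x \<in> ?H \<Longrightarrow> \<pi> x = x"
    using pair.linear_exists_left_inverse_on[OF _ subspace_cyclic_part, of "\<lambda>x. x" \<gamma>] by auto
  interpret \<pi>: Vector_Spaces.linear scale scale \<pi> by fact
  have \<pi>_H: "\<pi> x \<in> ?H" for x
    using \<pi>(2) by auto
  \<comment> \<open>Projecting both arguments gives a total Lie bracket; projecting only the acting
    one keeps the action on the whole color algebra.\<close>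
  define br where "br = (\<lambda>u v. bracket (\<pi> u) (\<pi> v))"
  define act where "act = (\<lambda>u. bracket (\<pi> u))"
  have \<pi>_br: "\<pi> (bracket (\<pi> u) (\<pi> v)) = bracket (\<pi> u) (\<pi> v)" for u v
    by (intro \<pi>(3) bracket_cyclic_part \<pi>_H)
  interpret lie: char_p_lie_algebra scale br p
  proof
    show "br u (br v w) = br (br u v) w + br v (br u w)" for u v w
      unfolding br_def \<pi>_br by (rule leibniz_cyclic_part[OF \<gamma>]) (rule \<pi>_H)+
    show "br u v = - br v u" for u v
      unfolding br_def by (rule antisym_cyclic_part[OF \<gamma>]) (rule \<pi>_H)+
  qed (simp_all add: p br_def \<pi>.add \<pi>.scale bracket.add_left bracket.add_right
      bracket_scale_left bracket_scale_right)
  have act: "biadditive act"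
    by unfold_locales (simp_all add: act_def \<pi>.add bracket.add_left bracket.add_right)
  have act_jacobson: "(act (u + v) ^^ p) w = (act u ^^ p) w + (act v ^^ p) w + act (lie.jacobson u v) w"
    for u v w
  proof (rule lie.act_jacobson[OF act])
    show "act a (act f g) = act (br a f) g + act f (act a g)" for a f g
      unfolding act_def br_def \<pi>_br by (rule leibniz_cyclic_part[OF \<gamma>]) (rule \<pi>_H)+
    show "act (scale c u) v = scale c (act u v)" for c u v
      by (simp add: act_def \<pi>.scale bracket_scale_left)
  qed
  have L_H: "L (nat_mult n \<gamma>) \<subseteq> ?H" "L \<gamma> \<subseteq> ?H" for n
    using L_subset_cyclic_part[of n \<gamma>] L_subset_cyclic_part[of "Suc 0" \<gamma>] by auto
  have pencil_br: "pencil br u v w m i = pencil bracket u v w m i"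
    if "u \<in> L \<gamma>" "v \<in> L \<gamma>" "w \<in> L \<gamma>" for u v w m i
  proof (induction m arbitrary: i)
    case (Suc m)
    have "\<pi> (pencil bracket u v w m i) = pencil bracket u v w m i" for i
      using pencil_degree[OF that] L_H by (intro \<pi>(3)) blast
    moreover have "\<pi> u = u" "\<pi> v = v"
      using that L_H by (auto intro!: \<pi>(3))
    ultimately show ?case
      by (simp only: pencil.simps Suc.IH) (simp add: br_def split: nat.split)
  qed simp
  have jacobson_s_br: "jacobson_s scale br p i u v = jacobson_s scale bracket p i u v"
    if "u \<in> L \<gamma>" "v \<in> L \<gamma>" for i u v
    using that by (simp add: jacobson_s_eq_pencil[OF lie.biadditive_axioms]
        jacobson_s_eq_pencil[OF bracket.biadditive_axioms] pencil_br)
  have jacobson: "lie.jacobson u v = (\<Sum>i=1..p-1. jacobson_s scale bracket p i u v)"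
    if "u \<in> L \<gamma>" "v \<in> L \<gamma>" for u v
    using that by (simp add: lie.jacobson_def jacobson_s_br)
  have jacobson_degree: "lie.jacobson u v \<in> L (nat_mult p \<gamma>)" if "u \<in> L \<gamma>" "v \<in> L \<gamma>" for u v
    using pencil_degree[OF that that(1), of "p - 1"] p that
    by (auto simp: lie.jacobson_eq_pencil pencil_br
        intro!: subspace_sum[OF subspace_L] subspace_scale[OF subspace_L])
  have act_L: "act u = bracket u" if "u \<in> L \<gamma> \<or> u \<in> L (nat_mult p \<gamma>)" for u
    using that L_H by (auto simp: act_def \<pi>(3) subset_eq)
  have B: "inj_on e J" "independent (e ` J)" "span (e ` J) = L \<gamma>"
    using basis by (auto simp: indexed_basis_def)
  \<comment> \<open>The inverse of \<open>e\<close> on \<open>J\<close> turns the prescribed values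
    into a function of the basis vectors.\<close>
  from lie.semilinear_section[OF B(2), of "\<lambda>b. y (the_inv_into J e b)", unfolded B(3)]
  obtain f where f:
    "\<forall>x\<in>L \<gamma>. \<forall>x'\<in>L \<gamma>. f (x + x') = f x + f x' + lie.jacobson x x'"
    "\<forall>x\<in>L \<gamma>. \<forall>c. f (scale c x) = scale (c ^ p) (f x)"
    "\<forall>b\<in>e ` J. f b = y (the_inv_into J e b)"
    by (elim exE conjE) (rule that)
  note f = f[rule_format]
  have f_e: "f (e j) = y j" if "j \<in> J" for j
    using that B(1) by (simp add: f(3) the_inv_into_f_f)
  have f_0: "f 0 = 0"
    using f(2)[of 0 0] p subspace_0[OF subspace_L] by (simp add: power_0_left)
  have e_L: "e j \<in> L \<gamma>" if "j \<in> J" for j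
    using that span_base[of "e j" "e ` J"] by (simp add: B(3))
  \<comment> \<open>Degree and \<open>ad\<close> condition are propagated along linear combinations
    of the basis. Membership in \<open>L \<gamma>\<close> is carried along because the rules for
    \<open>f\<close> are available only there.\<close>
  have f_L_ad: "u \<in> L \<gamma> \<and> f u \<in> L (nat_mult p \<gamma>) \<and> (\<forall>v. bracket (f u) v = (bracket u ^^ p) v)"
    if "u \<in> span (e ` J)" for u
    using that
  proof (induction rule: span_induct_alt)
    case base
    \<comment> \<open>Here \<open>p > 0\<close> matters: the zeroth power of the zero map is the
      identity.\<close>
    have "((\<lambda>_. 0) ^^ p) v = (0::'l)" for v :: 'l
      using p by (cases p) auto
    then show ?case
      by (simp add: f_0 bracket.zero subspace_0[OF subspace_L])
  next
    case (step c b u)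
    then obtain j where j: "j \<in> J" "b = e j"
      by auto
    have b: "scale c b \<in> L \<gamma>" "f (scale c b) = scale (c ^ p) (y j)"
      using j e_L f(2) f_e by (auto intro: subspace_scale[OF subspace_L])
    have pow: "(bracket (scale c b) ^^ n) v = scale (c ^ n) ((bracket b ^^ n) v)" for n v
      by (induction n) (simp_all add: bracket_scale_left bracket_scale_right mult.commute)
    have add: "f (scale c b + u) = scale (c ^ p) (y j) + f u + lie.jacobson (scale c b) u"
      using b step.IH by (simp add: f(1))
    have "(bracket (scale c b + u) ^^ p) v =
        (bracket (scale c b) ^^ p) v + (bracket u ^^ p) v + bracket (lie.jacobson (scale c b) u) v" for v
      using act_jacobson[of "scale c b" u v] b step.IH jacobson_degree[of "scale c b" u]
      by (simp add: act_L subspace_add[OF subspace_L])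
    moreover have "(bracket (scale c b) ^^ p) v = bracket (scale (c ^ p) (y j)) v" for v
      unfolding pow by (simp add: j(2) y_ad[OF j(1)] bracket_scale_left)
    moreover have "bracket (f (scale c b + u)) v = bracket (scale (c ^ p) (y j)) v + bracket (f u) v
        + bracket (lie.jacobson (scale c b) u) v" for v
      by (simp only: add bracket.add_left)
    moreover have "f (scale c b + u) \<in> L (nat_mult p \<gamma>)"
      using b step.IH y_degree[OF j(1)] jacobson_degree[of "scale c b" u]
      by (simp add: add subspace_add[OF subspace_L] subspace_scale[OF subspace_L])
    ultimately show ?case
      using b step.IH by (simp add: subspace_add[OF subspace_L])
  qed
  show ?thesis
    using f_L_ad f_e f by (intro exI[of _ f]) (simp add: B(3) jacobson)
qed

end

section \<open>Existence and uniqueness of the \<open>p\<close>-map\<close>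

theorem theorem3p6:
  fixes scale :: "'k::field \<Rightarrow> 'l::ab_group_add \<Rightarrow> 'l"
    and \<epsilon> :: "'g::ab_group_add \<Rightarrow> 'g \<Rightarrow> 'k"
    and L :: "'g \<Rightarrow> 'l set"
    and bracket :: "'l \<Rightarrow> 'l \<Rightarrow> 'l"
    and p :: nat
    and J :: "'g \<Rightarrow> 'j set"
    and e y :: "'g \<Rightarrow> 'j \<Rightarrow> 'l"
  assumes "CHAR('k) = p" and "p > 3"
    and "lie_color_algebra scale \<epsilon> L bracket"
    and "\<And>\<gamma>. \<gamma> \<in> G_plus \<epsilon> \<Longrightarrow> vector_space.indexed_basis scale (L \<gamma>) (J \<gamma>) (e \<gamma>)"
    and "\<And>\<gamma> j. \<lbrakk>\<gamma> \<in> G_plus \<epsilon>; j \<in> J \<gamma>\<rbrakk> \<Longrightarrow> y \<gamma> j \<in> L (nat_mult p \<gamma>)"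
    and "\<And>\<gamma> j. \<lbrakk>\<gamma> \<in> G_plus \<epsilon>; j \<in> J \<gamma>\<rbrakk> \<Longrightarrow> (bracket (e \<gamma> j) ^^ p) = bracket (y \<gamma> j)"
  shows "\<exists>!pmap. restricted_lie_color_algebra scale \<epsilon> L bracket p pmap \<and>
           (\<forall>\<gamma>\<in>G_plus \<epsilon>. \<forall>j\<in>J \<gamma>. pmap \<gamma> (e \<gamma> j) = y \<gamma> j)"
proof -
  interpret lie_color_algebra scale \<epsilon> L bracket by fact
  have B: "independent (e \<gamma> ` J \<gamma>)" "span (e \<gamma> ` J \<gamma>) = L \<gamma>" if "\<gamma> \<in> G_plus \<epsilon>" for \<gamma>
    using assms(4)[OF that] by (auto simp: indexed_basis_def)
  have e_L: "e \<gamma> j \<in> L \<gamma>" if "\<gamma> \<in> G_plus \<epsilon>" "j \<in> J \<gamma>" for \<gamma> j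
    using that span_base[of "e \<gamma> j" "e \<gamma> ` J \<gamma>"] by (simp add: B(2))
  \<comment> \<open>The axioms never relate values at different \<gamma>, so a component can be
    chosen for each \<gamma> separately.\<close>
  define P where "P = (\<lambda>\<gamma> f. f \<in> L \<gamma> \<rightarrow> L (nat_mult p \<gamma>)
      \<and> (\<forall>x\<in>L \<gamma>. \<forall>a. f (scale a x) = scale (a ^ p) (f x))
      \<and> (\<forall>x\<in>L \<gamma>. \<forall>v. bracket (f x) v = (bracket x ^^ p) v)
      \<and> (\<forall>x\<in>L \<gamma>. \<forall>x'\<in>L \<gamma>. f (x + x') = f x + f x' + (\<Sum>i=1..p-1. jacobson_s scale bracket p i x x'))
      \<and> (\<forall>j\<in>J \<gamma>. f (e \<gamma> j) = y \<gamma> j))"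
  define F where "F = (\<lambda>\<gamma>. SOME f. P \<gamma> f)"
  have "P \<gamma> (F \<gamma>)" if \<gamma>: "\<gamma> \<in> G_plus \<epsilon>" for \<gamma>
  proof -
    have "p > 2"
      using assms(2) by simp
    have "\<exists>f. P \<gamma> f"
      unfolding P_def
      by (rule pmap_component[OF assms(1) \<open>p > 2\<close> \<gamma> assms(4)[OF \<gamma>] assms(5,6)[OF \<gamma>]])
    then show ?thesis
      unfolding F_def by (rule someI_ex)
  qed
  then have F: "\<And>\<gamma>. \<gamma> \<in> G_plus \<epsilon> \<Longrightarrow> F \<gamma> \<in> L \<gamma> \<rightarrow> L (nat_mult p \<gamma>)"
    "\<And>\<gamma> x a. \<gamma> \<in> G_plus \<epsilon> \<Longrightarrow> x \<in> L \<gamma> \<Longrightarrow> F \<gamma> (scale a x) = scale (a ^ p) (F \<gamma> x)"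
    "\<And>\<gamma> x v. \<gamma> \<in> G_plus \<epsilon> \<Longrightarrow> x \<in> L \<gamma> \<Longrightarrow> bracket (F \<gamma> x) v = (bracket x ^^ p) v"
    "\<And>\<gamma> x x'. \<gamma> \<in> G_plus \<epsilon> \<Longrightarrow> x \<in> L \<gamma> \<Longrightarrow> x' \<in> L \<gamma> \<Longrightarrow>
       F \<gamma> (x + x') = F \<gamma> x + F \<gamma> x' + (\<Sum>i=1..p-1. jacobson_s scale bracket p i x x')"
    "\<And>\<gamma> j. \<gamma> \<in> G_plus \<epsilon> \<Longrightarrow> j \<in> J \<gamma> \<Longrightarrow> F \<gamma> (e \<gamma> j) = y \<gamma> j"
    by (auto simp: P_def)
  let ?pmap = "\<lambda>\<gamma>\<in>G_plus \<epsilon>. \<lambda>x\<in>L \<gamma>. F \<gamma> x"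
  show ?thesis
  proof (rule ex1I[of _ ?pmap])
    have "restricted_lie_color_algebra scale \<epsilon> L bracket p ?pmap"
    proof
      show "?pmap \<in> (\<Pi>\<^sub>E \<gamma>\<in>G_plus \<epsilon>. L \<gamma> \<rightarrow>\<^sub>E L (nat_mult p \<gamma>))"
        using F(1) by (intro PiE_I) (auto simp: Pi_iff)
    qed (use assms(1,2) F(2-4) in
      \<open>auto simp: subspace_add[OF subspace_L] subspace_scale[OF subspace_L]\<close>)
    then show "restricted_lie_color_algebra scale \<epsilon> L bracket p ?pmap \<and>
        (\<forall>\<gamma>\<in>G_plus \<epsilon>. \<forall>j\<in>J \<gamma>. ?pmap \<gamma> (e \<gamma> j) = y \<gamma> j)"
      by (simp add: e_L F(5))
  next
    fix g
    assume g: "restricted_lie_color_algebra scale \<epsilon> L bracket p g \<and>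
        (\<forall>\<gamma>\<in>G_plus \<epsilon>. \<forall>j\<in>J \<gamma>. g \<gamma> (e \<gamma> j) = y \<gamma> j)"
    then interpret g: restricted_lie_color_algebra scale \<epsilon> L bracket p g
      by blast
    \<comment> \<open>Semilinearity and the addition formula determine a \<open>p\<close>-map from
      its values on the basis; the induction compares \<open>g\<close> with
      \<open>F\<close>.\<close>
    have g_F: "x \<in> L \<gamma> \<and> g \<gamma> x = F \<gamma> x" if \<gamma>: "\<gamma> \<in> G_plus \<epsilon>" and "x \<in> span (e \<gamma> ` J \<gamma>)" for \<gamma> x
      using that(2)
    proof (induction rule: span_induct_alt)
      case base
      have "g \<gamma> 0 = 0" "F \<gamma> 0 = 0"
        using g.pmap_scale[OF \<gamma>, of 0 0] F(2)[OF \<gamma>, of 0 0] assms(2) subspace_0[OF subspace_L]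
        by (simp_all add: power_0_left)
      then show ?case
        by (simp add: subspace_0[OF subspace_L])
    next
      case (step c b x)
      then obtain j where j: "j \<in> J \<gamma>" "b = e \<gamma> j"
        by auto
      then have "b \<in> L \<gamma>" "g \<gamma> b = F \<gamma> b"
        using g \<gamma> by (auto simp: e_L F(5))
      moreover from this have "scale c b \<in> L \<gamma>"
        by (intro subspace_scale[OF subspace_L])
      ultimately show ?case
        using step.IH \<gamma>
        by (simp add: g.pmap_add F(4) g.pmap_scale F(2) subspace_add[OF subspace_L])
    qed
    show "g = ?pmap"
    \<comment> \<open>Extensionality is used twice, over the degrees in
      \<open>G_plus \<epsilon>\<close> and then over \<open>L \<gamma>\<close>.\<close>
    proof (rule PiE_ext[OF g.pmap_maps])
      show "?pmap \<in> (\<Pi>\<^sub>E \<gamma>\<in>G_plus \<epsilon>. L \<gamma> \<rightarrow>\<^sub>E L (nat_mult p \<gamma>))"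
        using F(1) by (intro PiE_I) (auto simp: Pi_iff)
      fix \<gamma> assume \<gamma>: "\<gamma> \<in> G_plus \<epsilon>"
      then have "g \<gamma> \<in> L \<gamma> \<rightarrow>\<^sub>E L (nat_mult p \<gamma>)"
        using g.pmap_maps by (rule PiE_mem[rotated])
      moreover have "(\<lambda>x\<in>L \<gamma>. F \<gamma> x) \<in> L \<gamma> \<rightarrow>\<^sub>E L (nat_mult p \<gamma>)"
        using F(1)[OF \<gamma>] by (auto simp: Pi_iff)
      ultimately have "g \<gamma> = (\<lambda>x\<in>L \<gamma>. F \<gamma> x)"
        by (rule PiE_ext) (use g_F[OF \<gamma>] B(2)[OF \<gamma>] in auto)
      then show "g \<gamma> = ?pmap \<gamma>"
        using \<gamma> by simp
    qed
  qed
qed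

end
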